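(* Let $\mathsf{K},\mathsf{L}$ be kernels on $S$, and let $\mathbf{D}_{\mathsf{L}}\mathsf{K}$ be the kernel defined by $\mathfrak{w}_{\mathbf{D}_{\mathsf{L}}\mathsf{K}}:=\mathbf{D}_{\mathfrak{w}_{\mathsf{L}}}\mathfrak{w}_{\mathsf{K}}$. Then the decomposition $$\mathsf{K}=\mathbf{D}_{\mathsf{L}}\mathsf{K}+(\mathsf{K}-\mathbf{D}_{\mathsf{L}}\mathsf{K})$$ is a Lebesgue-type decomposition of $\mathsf{K}$ with respect to $\mathsf{L}$; that is, $\mathbf{D}_{\mathsf{L}}\mathsf{K}$ is strongly $\mathsf{L}$-absolutely continuous and $\mathsf{K}-\mathbf{D}_{\mathsf{L}}\mathsf{K}$ is $\mathsf{L}$-singular. Moreover, for every $f\in\mathfrak{X}$, $$\mathfrak{w}_{\mathbf{D}_{\mathsf{L}}\mathsf{K}}[f]=\inf\Big\{\lim_{n\to+\infty}\mathfrak{w}_{\mathsf{K}}[f-g_n]\ \Big|\ (g_n)_{n\in\mathbb{N}}\in\mathfrak{X}^{\mathbb{N}}:\ (\mathfrak{w}_{\mathsf{K}}[g_n-g_m]\to0)\wedge(\mathfrak{w}_{\mathsf{L}}[g_n]\to0)\Big\}$$ and $$\mathfrak{w}_{\mathbf{D}_{\mathsf{L}}\mathsf{K}}[f]=\inf\Big\{\liminf_{n\to+\infty}\mathfrak{w}_{\mathsf{K}}[f-g_n]\ \Big|\ (g_n)_{n\in\mathbb{N}}\in\mathfrak{X}^{\mathbb{N}}:\ \mathfrak{w}_{\mathsf{L}}[g_n]\to0\Big\}.$$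 The Lebesgue-type decomposition of $\mathsf{K}$ with respect to $\mathsf{L}$ is unique precisely when $\mathbf{D}_{\mathsf{L}}\mathsf{K}$ is dominated by $\mathsf{L}$.
   Context: Let $S$ be a non-empty set and $\mathfrak{E}$ a complex Banach space with topological dual $\mathfrak{E}^{*}$. The dual pairing $\langle\cdot,\cdot\rangle:\mathfrak{E}\times\mathfrak{E}^{*}\to\mathbb{C}$ is taken linear in the first and conjugate linear in the second variable (the vector space structure of $\mathfrak{E}^*$ is chosen accordingly). $\mathbf{B}(\mathfrak{E},\mathfrak{E}^{*})$ is the space of bounded linear operators from $\mathfrak{E}$ to $\mathfrak{E}^*$. $\mathfrak{X}$ is the complex linear space of finitely supported functions $f:S\to\mathfrak{E}$. A kernel on $S$ is a function $\mathsf{K}:S\times S\to\mathbf{B}(\mathfrak{E},\mathfrak{E}^{*})$ with $\sum_{s,t\in S}\langle f(t),\mathsf{K}(s,t)f(s)\rangle\ge0$ for all $f\in\mathfrak{X}$. Kernels are added pointwise. A form on $\mathfrak{X}$ is a map $\mathfrak{t}:\mathfrak{X}\times\mathfrak{X}\to\mathbb{C}$, linear in the first and antilinear in the second argument, with $\mathfrak{t}[x]:=\mathfrak{t}(x,x)\ge0$ for all $x$. Write $\mathfrak{t}\le\mathfrak{w}$ if $\mathfrak{t}[x]\le\mathfrak{w}[x]$ for all $x$. For forms: $\mathfrak{t}$ is dominated by $\mathfrak{w}$ if $\mathfrak{t}\le c\,\mathfrak{w}$ for some constant $c$; $\mathfrak{t}$ is strongly $\mathfrak{w}$-absolutely continuous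 if for every sequence $(x_n)$ in $\mathfrak{X}$, $\mathfrak{t}[x_n-x_m]\to0$ and $\mathfrak{w}[x_n]\to0$ imply $\mathfrak{t}[x_n]\to0$; $\mathfrak{t}$ and $\mathfrak{w}$ are singular (also: $\mathfrak{t}$ is $\mathfrak{w}$-singular) if the only form $\mathfrak{s}$ with $\mathfrak{s}\le\mathfrak{t}$ and $\mathfrak{s}\le\mathfrak{w}$ is $\mathfrak{s}=0$. The parallel sum of forms is the form given by $(\mathfrak{t}:\mathfrak{w})[x]=\inf_{y\in\mathfrak{X}}\{\mathfrak{t}[x-y]+\mathfrak{w}[y]\}$, and $\mathbf{D}_{\mathfrak{w}}\mathfrak{t}:=\sup_{n\in\mathbb{N}}(\mathfrak{t}:n\mathfrak{w})$ (pointwise supremum of quadratic forms), which is a form with $\mathbf{D}_{\mathfrak{w}}\mathfrak{t}\le\mathfrak{t}$. The form associated with a kernel $\mathsf{K}$ is $\mathfrak{w}_{\mathsf{K}}(f,g)=\sum_{s,t\in S}\langle f(t),\mathsf{K}(s,t)g(s)\rangle$. Every form $\mathfrak{w}\le\mathfrak{w}_{\mathsf{K}}$ is the associated form of a unique kernel, so $\mathbf{D}_{\mathsf{L}}\mathsf{K}$ is well defined. Domination, strong absolute continuity and singularity of kernels mean the corresponding property of their associated forms. A Lebesgue-type decomposition of $\mathsf{K}$ with respect to $\mathsf{L}$ is a decomposition $\mathsf{K}=\mathsf{K}_1+\mathsf{K}_2$ into kernels with $\mathsf{K}_1$ strongly $\mathsf{L}$-absolutely continuous and $\mathsf{K}_2$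 $\mathsf{L}$-singular. *)

theory Defs
  imports "HOL-Analysis.Analysis" "HOL-Library.Poly_Mapping" "HOL-Library.Nonpos_Ints"
begin

class complex_vector = ab_group_add +
  fixes scaleC :: "complex \<Rightarrow> 'a \<Rightarrow> 'a"  (infixr "*\<^sub>C" 75)
  assumes scaleC_add_right: "c *\<^sub>C (x + y) = c *\<^sub>C x + c *\<^sub>C y"
    and scaleC_add_left: "(c + d) *\<^sub>C x = c *\<^sub>C x + d *\<^sub>C x"
    and scaleC_scaleC: "c *\<^sub>C d *\<^sub>C x = (c * d) *\<^sub>C x"
    and scaleC_one: "1 *\<^sub>C x = x"

text \<open>A complex Banach space is a real Banach space with a compatible complex scalar
  multiplication for which the norm is homogeneous.\<close>

class complex_banach = banach + complex_vector +
  assumes scaleR_scaleC: "r *\<^sub>R x = of_real r *\<^sub>C x"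
    and norm_scaleC: "norm (c *\<^sub>C x) = cmod c * norm x"

text \<open>The space of finitely supported functions on the index set is \<open>'s \<Rightarrow>\<^sub>0 'e\<close>; the index set
  is the type \<open>'s\<close>, which is arbitrary and automatically non-empty.\<close>

instantiation poly_mapping :: (type, complex_vector) complex_vector
begin

lift_definition scaleC_poly_mapping :: "complex \<Rightarrow> ('a \<Rightarrow>\<^sub>0 'b) \<Rightarrow> ('a \<Rightarrow>\<^sub>0 'b)"
  is "\<lambda>c f s. c *\<^sub>C f s"
proof -
  fix c and f :: "'a \<Rightarrow> 'b"
  assume fin: "finite {s. f s \<noteq> 0}"
  have "c *\<^sub>C (0::'b) = 0"
    using scaleC_add_right[of c "0::'b" "0::'b"] by simp
  then have "{s. c *\<^sub>C f s \<noteq> 0} \<subseteq> {s. f s \<noteq> 0}" by auto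
  then show "finite {s. c *\<^sub>C f s \<noteq> 0}" using fin by (rule finite_subset)
qed

instance
  by standard
    (transfer; auto simp: scaleC_add_right scaleC_add_left scaleC_scaleC scaleC_one)+

end


section \<open>Forms\<close>

type_synonym 'v form = "'v \<Rightarrow> 'v \<Rightarrow> complex"

definition is_form :: "'v::complex_vector form \<Rightarrow> bool" where
  "is_form t \<longleftrightarrow>
     (\<forall>x x' y. t (x + x') y = t x y + t x' y) \<and>
     (\<forall>c x y. t (c *\<^sub>C x) y = c * t x y) \<and>
     (\<forall>x y y'. t x (y + y') = t x y + t x y') \<and>
     (\<forall>c x y. t x (c *\<^sub>C y) = cnj c * t x y) \<and>
     (\<forall>x. t x x \<in> \<real>\<^sub>\<ge>\<^sub>0)"

definition quad :: "'v form \<Rightarrow> 'v \<Rightarrow> real" where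
  "quad t x = Re (t x x)"

definition form_le :: "'v form \<Rightarrow> 'v form \<Rightarrow> bool" where
  "form_le t w \<longleftrightarrow> (\<forall>x. quad t x \<le> quad w x)"

definition form_scale :: "real \<Rightarrow> 'v form \<Rightarrow> 'v form" where
  "form_scale c t = (\<lambda>x y. of_real c * t x y)"

definition form_dominated :: "'v form \<Rightarrow> 'v form \<Rightarrow> bool" where
  "form_dominated t w \<longleftrightarrow> (\<exists>c. form_le t (form_scale c w))"

definition form_cauchy :: "'v::ab_group_add form \<Rightarrow> (nat \<Rightarrow> 'v) \<Rightarrow> bool" where
  "form_cauchy t x \<longleftrightarrow>
     ((\<lambda>(n, m). quad t (x n - x m)) \<longlongrightarrow> 0) (sequentially \<times>\<^sub>F sequentially)"

definition form_strongly_ac :: "'v::ab_group_add form \<Rightarrow> 'v form \<Rightarrow> bool" where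
  "form_strongly_ac t w \<longleftrightarrow>
     (\<forall>x. form_cauchy t x \<and> (\<lambda>n. quad w (x n)) \<longlonglongrightarrow> 0 \<longrightarrow> (\<lambda>n. quad t (x n)) \<longlonglongrightarrow> 0)"

definition form_singular :: "'v::complex_vector form \<Rightarrow> 'v form \<Rightarrow> bool" where
  "form_singular t w \<longleftrightarrow>
     (\<forall>s. is_form s \<and> form_le s t \<and> form_le s w \<longrightarrow> s = (\<lambda>x y. 0))"

text \<open>By polarization there is at most one form with a given quadratic form.\<close>

definition form_of_quad :: "('v::complex_vector \<Rightarrow> real) \<Rightarrow> 'v form" where
  "form_of_quad q = (THE t. is_form t \<and> (\<forall>x. quad t x = q x))"

definition parallel_sum :: "'v::complex_vector form \<Rightarrow> 'v form \<Rightarrow> 'v form" where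
  "parallel_sum t w = form_of_quad (\<lambda>x. INF y. quad t (x - y) + quad w y)"

text \<open>\<open>form_D w t\<close> is \<open>D\<^sub>w t\<close>. The supremum is over a set of reals bounded by \<open>quad t x\<close>.\<close>

definition form_D :: "'v::complex_vector form \<Rightarrow> 'v form \<Rightarrow> 'v form" where
  "form_D w t = form_of_quad (\<lambda>x. SUP n::nat. quad (parallel_sum t (form_scale (real n) w)) x)"


section \<open>Kernels\<close>

text \<open>The topological dual consists of the bounded complex linear functionals, with pairing
  \<open>\<langle>x, \<phi>\<rangle> = \<phi> x\<close>. For the pairing to be conjugate linear in the second variable, scalars act on
  the dual by \<open>(c \<phi>) x = cnj c * \<phi> x\<close>. Norms and addition are those of \<open>'e \<Rightarrow>\<^sub>L complex\<close>, so the
  bounded linear operators from \<open>'e\<close> to its dual are those elements of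
  \<open>'e \<Rightarrow>\<^sub>L ('e \<Rightarrow>\<^sub>L complex)\<close> which take values in the dual and are complex linear for this action.\<close>

definition dual_space :: "('e::complex_banach \<Rightarrow>\<^sub>L complex) set" where
  "dual_space = {\<phi>. \<forall>c x. blinfun_apply \<phi> (c *\<^sub>C x) = c * blinfun_apply \<phi> x}"

definition dual_scale ::
    "complex \<Rightarrow> ('e::complex_banach \<Rightarrow>\<^sub>L complex) \<Rightarrow> ('e \<Rightarrow>\<^sub>L complex)" where
  "dual_scale c \<phi> = blinfun_mult_right (cnj c) o\<^sub>L \<phi>"

definition pairing :: "'e::complex_banach \<Rightarrow> ('e \<Rightarrow>\<^sub>L complex) \<Rightarrow> complex" where
  "pairing x \<phi> = blinfun_apply \<phi> x"

definition bounded_ops :: "('e::complex_banach \<Rightarrow>\<^sub>L ('e \<Rightarrow>\<^sub>L complex)) set" where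
  "bounded_ops = {T. (\<forall>x. blinfun_apply T x \<in> dual_space) \<and>
     (\<forall>c x. blinfun_apply T (c *\<^sub>C x) = dual_scale c (blinfun_apply T x))}"

type_synonym ('s, 'e) op_fun = "'s \<Rightarrow> 's \<Rightarrow> ('e \<Rightarrow>\<^sub>L ('e \<Rightarrow>\<^sub>L complex))"

text \<open>The double sum is restricted to the supports; all other terms vanish.\<close>

definition kernel_form :: "('s, 'e::complex_banach) op_fun \<Rightarrow> ('s \<Rightarrow>\<^sub>0 'e) form" where
  "kernel_form K f g =
     (\<Sum>s\<in>Poly_Mapping.keys g. \<Sum>t\<in>Poly_Mapping.keys f.
        pairing (Poly_Mapping.lookup f t) (blinfun_apply (K s t) (Poly_Mapping.lookup g s)))"

definition is_kernel :: "('s, 'e::complex_banach) op_fun \<Rightarrow> bool" where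
  "is_kernel K \<longleftrightarrow> (\<forall>s t. K s t \<in> bounded_ops) \<and> (\<forall>f. kernel_form K f f \<in> \<real>\<^sub>\<ge>\<^sub>0)"

definition kernel_dominated ::
    "('s, 'e::complex_banach) op_fun \<Rightarrow> ('s, 'e) op_fun \<Rightarrow> bool" where
  "kernel_dominated K L \<longleftrightarrow> form_dominated (kernel_form K) (kernel_form L)"

definition kernel_strongly_ac ::
    "('s, 'e::complex_banach) op_fun \<Rightarrow> ('s, 'e) op_fun \<Rightarrow> bool" where
  "kernel_strongly_ac K L \<longleftrightarrow> form_strongly_ac (kernel_form K) (kernel_form L)"

definition kernel_singular ::
    "('s, 'e::complex_banach) op_fun \<Rightarrow> ('s, 'e) op_fun \<Rightarrow> bool" where
  "kernel_singular K L \<longleftrightarrow> form_singular (kernel_form K) (kernel_form L)"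

definition lebesgue_type_decomposition ::
    "('s, 'e::complex_banach) op_fun \<Rightarrow> ('s, 'e) op_fun \<Rightarrow>
     ('s, 'e) op_fun \<Rightarrow> ('s, 'e) op_fun \<Rightarrow> bool" where
  "lebesgue_type_decomposition K L K1 K2 \<longleftrightarrow>
     is_kernel K1 \<and> is_kernel K2 \<and> (\<forall>s t. K s t = K1 s t + K2 s t) \<and>
     kernel_strongly_ac K1 L \<and> kernel_singular K2 L"

definition kernel_D ::
    "('s, 'e::complex_banach) op_fun \<Rightarrow> ('s, 'e) op_fun \<Rightarrow> ('s, 'e) op_fun" where
  "kernel_D L K =
     (THE D. is_kernel D \<and> kernel_form D = form_D (kernel_form L) (kernel_form K))"

end

theory Submission
  imports Defs
begin

text \<open>Write \<open>t, w\<close> for the forms of the two kernels and \<open>D = D\<^sub>w t\<close>. Near-minimizers \<open>g\<^sub>n\<close> of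
  \<open>y \<mapsto> t[f - y] + n w[y]\<close> form a \<open>t\<close>-Cauchy, \<open>w\<close>-null sequence with \<open>t[f - g\<^sub>n] \<rightarrow> D[f]\<close>, while
  \<open>D\<close>, as a supremum of forms bounded by multiples of \<open>w\<close>, is lower semicontinuous along \<open>w\<close>-null
  sequences; this yields both formulas, the absolute continuity of \<open>D\<close>, the singularity of
  \<open>t - D\<close> and the maximality of \<open>D\<close>. If \<open>D\<close> is not dominated by \<open>w\<close>, uniform boundedness
  provides a linear functional \<open>\<phi>\<close> with \<open>|\<phi>|\<^sup>2 \<le> D/4\<close> which is not \<open>w\<close>-bounded, and
  \<open>(D - |\<phi>|\<^sup>2) + (t - D + |\<phi>|\<^sup>2)\<close> is a second decomposition.\<close>

text \<open>The forms are only seminorms squared on a space that need not be complete, so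
  minimizers, projections and representing vectors may fail to exist. Sequences replace them: infima
  are only approached, and \<open>\<phi>\<close> is a limit of functionals \<open>D(_, v n)\<close>
  whose \<open>v n\<close> need not converge. The gliding hump takes the place of uniform
  boundedness in the completion and yields quantitative constants. The factor 1/4 leaves
  \<open>D - |\<phi>|\<^sup>2\<close> above \<open>3/4 D\<close>, so that absolute continuity
  carries over from \<open>D\<close>. The delicate half is singularity, because a sum of two
  singular forms can fail to be singular: one sequence has to serve \<open>t - D\<close> and
  \<open>|\<phi>|\<^sup>2\<close> at once. It exists because the recovery sequences are also
  \<open>D\<close>-null, hence \<open>\<phi>\<close>-null. They can therefore correct
  \<open>w\<close>-null points with \<open>\<phi> = 1\<close> until \<open>t - D\<close> vanishes
  along them as well, while \<open>\<phi>\<close> stays close to 1; adding multiples of the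
  corrected points adjusts \<open>\<phi>\<close> at no cost in \<open>w\<close> or in
  \<open>t - D\<close>.\<close>

lemma scaleC_zero_right [simp]: "c *\<^sub>C (0::'v::complex_vector) = 0"
  using scaleC_add_right[of c "0::'v" 0] by simp

lemma scaleC_zero_left [simp]: "0 *\<^sub>C (x::'v::complex_vector) = 0"
  using scaleC_add_left[of 0 0 x] by simp

lemma scaleC_minus_left: "(- c) *\<^sub>C (x::'v::complex_vector) = - (c *\<^sub>C x)"
  using scaleC_add_left[of c "- c" x] by (simp add: eq_neg_iff_add_eq_0 add.commute)

lemma scaleC_minus_right: "c *\<^sub>C (- x) = - (c *\<^sub>C (x::'v::complex_vector))"
  using scaleC_add_right[of c x "- x"] by (simp add: eq_neg_iff_add_eq_0 add.commute)

lemma scaleC_diff_right: "c *\<^sub>C (x - y) = c *\<^sub>C x - c *\<^sub>C (y::'v::complex_vector)"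
  using scaleC_add_right[of c x "- y"] by (simp add: scaleC_minus_right)

lemma scaleC_half_double: "(1/2) *\<^sub>C (x + x) = (x::'v::complex_vector)"
  using scaleC_add_left[of "1/2" "1/2" x] by (simp add: scaleC_add_right scaleC_one)

lemma scaleC_two: "2 *\<^sub>C x = x + (x::'v::complex_vector)"
  using scaleC_add_left[of 1 1 x] by (simp add: scaleC_one)

section \<open>Nonnegative sesquilinear forms\<close>

lemma
  assumes "is_form t"
  shows form_add_left: "t (x + y) z = t x z + t y z"
    and form_scaleC_left: "t (c *\<^sub>C x) z = c * t x z"
    and form_add_right: "t z (x + y) = t z x + t z y"
    and form_scaleC_right: "t z (c *\<^sub>C x) = cnj c * t z x"
    and form_self_nonneg: "t x x \<in> \<real>\<^sub>\<ge>\<^sub>0"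
  using assms by (auto simp: is_form_def)

lemma form_self_eq: "is_form t \<Longrightarrow> t x x = of_real (quad t x)"
  using form_self_nonneg[of t x]
  by (auto simp: quad_def nonneg_Reals_def)

lemma quad_nonneg: "is_form t \<Longrightarrow> 0 \<le> quad t x"
  using form_self_nonneg[of t x] by (auto simp: quad_def nonneg_Reals_def)

lemma
  assumes "is_form t"
  shows form_minus_left: "t (- x) z = - t x z"
    and form_minus_right: "t z (- x) = - t z x"
    and form_diff_left: "t (x - y) z = t x z - t y z"
    and form_diff_right: "t z (x - y) = t z x - t z y"
proof -
  show a: "t (- x) z = - t x z" for x
    using form_scaleC_left[OF assms, of "-1" x z] by (simp add: scaleC_minus_left scaleC_one)
  show b: "t z (- x) = - t z x" for x
    using form_scaleC_right[OF assms, of z "-1" x] by (simp add: scaleC_minus_left scaleC_one)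
  show "t (x - y) z = t x z - t y z"
    using form_add_left[OF assms, of x "- y" z] by (simp add: a)
  show "t z (x - y) = t z x - t z y"
    using form_add_right[OF assms, of z x "- y"] by (simp add: b)
qed

lemmas form_simps = form_add_left form_add_right form_scaleC_left form_scaleC_right
  form_minus_left form_minus_right form_diff_left form_diff_right

text \<open>Diagonal values are real: at \<open>x + y\<close> this relates the imaginary parts of
  \<open>t x y\<close> and \<open>t y x\<close>, at \<open>x + i y\<close> their real parts.\<close>

lemma form_hermitian:
  assumes "is_form t" shows "t y x = cnj (t x y)"
proof -
  have i: "Im (t z z) = 0" for z
    using form_self_eq[OF assms, of z] by simp
  have "Im (t x y) + Im (t y x) = 0"
    using i[of "x + y"] by (simp add: form_simps[OF assms] i)
  moreover have "Re (t x y) = Re (t y x)"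
    using i[of "x + \<i> *\<^sub>C y"] by (simp add: form_simps[OF assms] i)
  ultimately show ?thesis by (simp add: complex_eq_iff)
qed

lemma quad_add:
  assumes "is_form t" shows "quad t (x + y) = quad t x + 2 * Re (t x y) + quad t y"
  using form_hermitian[OF assms, of y x] by (simp add: quad_def form_simps[OF assms])

lemma quad_diff:
  assumes "is_form t" shows "quad t (x - y) = quad t x - 2 * Re (t x y) + quad t y"
  using form_hermitian[OF assms, of y x] by (simp add: quad_def form_simps[OF assms])

lemma quad_scaleC:
  assumes "is_form t" shows "quad t (c *\<^sub>C x) = (cmod c)\<^sup>2 * quad t x"
proof -
  have "t (c *\<^sub>C x) (c *\<^sub>C x) = (c * cnj c) * t x x"
    by (simp add: form_simps[OF assms])
  also have "\<dots> = of_real ((cmod c)\<^sup>2 * quad t x)"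
    by (simp add: complex_norm_square[symmetric] form_self_eq[OF assms])
  finally show ?thesis by (simp add: quad_def)
qed

lemma quad_zero [simp]: "is_form t \<Longrightarrow> quad t 0 = 0"
  using quad_scaleC[of t 0 0] by simp

lemma quad_minus [simp]: "is_form t \<Longrightarrow> quad t (- x) = quad t x"
  using quad_scaleC[of t "-1" x] by (simp add: scaleC_minus_left scaleC_one)

lemma quad_minus_commute: "is_form t \<Longrightarrow> quad t (x - y) = quad t (y - x)"
  using quad_minus[of t "x - y"] by simp

lemma form_cauchy_schwarz:
  assumes t: "is_form t" shows "(cmod (t x y))\<^sup>2 \<le> quad t x * quad t y"
proof -
  define z where "z = t x y"
  \<comment> \<open>The multiplier \<open>r z\<close> carries the phase of \<open>t x y\<close>,
    which makes the cross term real. The value \<open>r = 1 / quad t y\<close> is optimal; for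
    \<open>quad t y = 0\<close> a large \<open>r\<close> is contradictory.\<close>
  have key: "2 * r * (cmod z)\<^sup>2 \<le> quad t x + r\<^sup>2 * (cmod z)\<^sup>2 * quad t y" for r :: real
  proof -
    have "0 \<le> quad t (x - (of_real r * z) *\<^sub>C y)" by (rule quad_nonneg[OF t])
    also have "\<dots> = quad t x - 2 * (r * (cmod z)\<^sup>2) + (\<bar>r\<bar> * cmod z)\<^sup>2 * quad t y"
      by (simp add: quad_diff[OF t] form_simps[OF t] z_def[symmetric] quad_scaleC[OF t] norm_mult
          cmod_power2 algebra_simps power2_eq_square[of "Re z"] power2_eq_square[of "Im z"])
    finally show ?thesis by (simp add: power_mult_distrib algebra_simps)
  qed
  show ?thesis
  proof (cases "z = 0")
    case True then show ?thesis using quad_nonneg[OF t] by (simp add: z_def[symmetric])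
  next
    case False
    then have z0: "0 < (cmod z)\<^sup>2" by simp
    show ?thesis
    proof (cases "quad t y = 0")
      case True
      then have "2 * quad t x + 2 \<le> quad t x"
        using key[of "(quad t x + 1) / (cmod z)\<^sup>2"] \<open>z \<noteq> 0\<close> by simp
      moreover have "0 \<le> quad t x" by (rule quad_nonneg[OF t])
      ultimately show ?thesis by linarith
    next
      case False
      then have y: "0 < quad t y" using quad_nonneg[OF t, of y] by linarith
      have "2 * (cmod z)\<^sup>2 / quad t y \<le> quad t x + (cmod z)\<^sup>2 / quad t y"
        using key[of "1 / quad t y"] y by (simp add: power2_eq_square field_simps)
      with y show ?thesis by (simp add: z_def field_simps)
    qed
  qed
qed

lemma cmod_form_le: "is_form t \<Longrightarrow> cmod (t x y) \<le> sqrt (quad t x) * sqrt (quad t y)"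
  using real_le_rsqrt[OF form_cauchy_schwarz[of t x y]] by (simp add: real_sqrt_mult)

lemma sqrt_quad_triangle:
  assumes t: "is_form t" shows "sqrt (quad t (x + y)) \<le> sqrt (quad t x) + sqrt (quad t y)"
proof -
  have "Re (t x y) \<le> sqrt (quad t x) * sqrt (quad t y)"
    using cmod_form_le[OF t, of x y] complex_Re_le_cmod[of "t x y"] by linarith
  then have "quad t (x + y) \<le> (sqrt (quad t x) + sqrt (quad t y))\<^sup>2"
    by (simp add: quad_add[OF t] power2_sum quad_nonneg[OF t])
  then show ?thesis by (intro real_le_lsqrt) (auto simp: quad_nonneg[OF t])
qed

lemma sqrt_quad_diff:
  assumes t: "is_form t"
  shows "\<bar>sqrt (quad t x) - sqrt (quad t y)\<bar> \<le> sqrt (quad t (x - y))"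
  using sqrt_quad_triangle[OF t, of "x - y" y] sqrt_quad_triangle[OF t, of "y - x" x]
  by (simp add: quad_minus_commute[OF t, of y x])

lemma quad_parallelogram:
  assumes "is_form t" shows "quad t (x + y) + quad t (x - y) = 2 * quad t x + 2 * quad t y"
  by (simp add: quad_add[OF assms] quad_diff[OF assms])

lemma quad_le_add:
  assumes "is_form t" shows "quad t (x + y) \<le> 2 * quad t x + 2 * quad t y"
  using quad_parallelogram[OF assms, of x y] quad_nonneg[OF assms, of "x - y"] by linarith

lemma quad_le_diff:
  assumes "is_form t" shows "quad t (x - y) \<le> 2 * quad t x + 2 * quad t y"
  using quad_parallelogram[OF assms, of x y] quad_nonneg[OF assms, of "x + y"] by linarith

lemma form_eqI:
  assumes t: "is_form t" and s: "is_form s" and q: "\<And>x. quad t x = quad s x"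
  shows "t = s"
proof (intro ext)
  fix x y
  have re: "Re (t x y) = Re (s x y)" for x y
    using q[of "x + y"] q[of x] q[of y] by (simp add: quad_add[OF t] quad_add[OF s])
  have "Im (t x y) = Im (s x y)"
    using re[of x "\<i> *\<^sub>C y"] by (simp add: form_simps[OF t] form_simps[OF s])
  with re show "t x y = s x y" by (simp add: complex_eq_iff)
qed

section \<open>Quadratic functionals\<close>

text \<open>The parallelogram law appears only as an inequality because this is what an infimum
  delivers directly.\<close>

definition quadratic_functional :: "('v::complex_vector \<Rightarrow> real) \<Rightarrow> bool" where
  "quadratic_functional q \<longleftrightarrow> (\<forall>x. 0 \<le> q x) \<and> (\<forall>c x. q (c *\<^sub>C x) = (cmod c)\<^sup>2 * q x) \<and>
     (\<forall>x y. q (x + y) + q (x - y) \<le> 2 * q x + 2 * q y)"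

text \<open>The deviation \<open>h\<close> from linearity is additive and vanishes on the integers,
  so it has period 1 and is bounded everywhere; \<open>h (n r) = n h r\<close> then forces it to be
  zero.\<close>

lemma additive_bounded_linear:
  fixes g :: "real \<Rightarrow> real"
  assumes add: "\<And>r s. g (r + s) = g r + g s" and bd: "\<And>r. \<bar>r\<bar> \<le> 1 \<Longrightarrow> \<bar>g r\<bar> \<le> M"
  shows "g r = r * g 1"
proof -
  define h where "h r = g r - r * g 1" for r
  have hadd: "h (r + s) = h r + h s" for r s by (simp add: h_def add algebra_simps)
  have h0: "h 0 = 0" using hadd[of 0 0] by simp
  have hneg: "h (- r) = - h r" for r using hadd[of r "- r"] h0 by simp
  have hnat: "h (real n * r) = real n * h r" for n r
    by (induction n) (simp_all add: h0 hadd algebra_simps)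
  have h1: "h 1 = 0" by (simp add: h_def)
  have hnat1: "h (real n) = 0" for n using hnat[of n 1] h1 by simp
  have hint: "h (of_int i) = 0" for i
  proof (cases "i \<ge> 0")
    case True then show ?thesis using hnat1[of "nat i"] by simp
  next
    case False then show ?thesis using hnat1[of "nat (- i)"] hneg[of "real_of_int i"] by simp
  qed
  have hb: "\<bar>h s\<bar> \<le> M + \<bar>g 1\<bar>" for s
  proof -
    have "h s = h (frac s)" using hadd[of "frac s" "of_int \<lfloor>s\<rfloor>"] hint by (simp add: frac_def)
    moreover have "\<bar>frac s\<bar> \<le> 1" using frac_ge_0[of s] frac_lt_1[of s] by linarith
    then have "\<bar>g (frac s)\<bar> \<le> M" "\<bar>frac s * g 1\<bar> \<le> \<bar>g 1\<bar>"
      using bd by (auto simp: abs_mult intro: mult_left_le_one_le)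
    ultimately show ?thesis unfolding h_def by linarith
  qed
  have "h r = 0"
  proof (rule ccontr)
    assume "h r \<noteq> 0"
    then obtain n where "M + \<bar>g 1\<bar> < real n * \<bar>h r\<bar>"
      using reals_Archimedean3[of "\<bar>h r\<bar>"] by auto
    with hb[of "real n * r"] show False by (simp add: hnat abs_mult)
  qed
  then show ?thesis by (simp add: h_def)
qed

text \<open>Jordan--von Neumann. Replacing \<open>x, y\<close> by \<open>x + y, x - y\<close> turns the parallelogram
  inequality into the equality.\<close>

lemma form_of_quadratic_functional:
  assumes "quadratic_functional (q :: 'v::complex_vector \<Rightarrow> real)"
  shows "\<exists>t. is_form t \<and> (\<forall>x. quad t x = q x)"
proof -
  have pos: "0 \<le> q x" and hom: "q (c *\<^sub>C x) = (cmod c)\<^sup>2 * q x"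
    and ple: "q (x + y) + q (x - y) \<le> 2 * q x + 2 * q y" for c x y
    using assms by (auto simp: quadratic_functional_def)
  have dbl: "q (x + x) = 4 * q x" for x using hom[of 2 x] by (simp add: scaleC_two)
  have q0: "q 0 = 0" using hom[of 0 0] by simp
  have qneg: "q (- x) = q x" for x using hom[of "-1" x] by (simp add: scaleC_minus_left scaleC_one)
  have qsub: "q (x - y) = q (y - x)" for x y using qneg[of "x - y"] by simp
  have pl: "q (x + y) + q (x - y) = 2 * q x + 2 * q y" for x y
  proof -
    have e: "x + y + (x - y) = x + x" "x + y - (x - y) = y + y" by (simp_all add: algebra_simps)
    show ?thesis using ple[of "x + y" "x - y"] ple[of x y] unfolding e dbl by linarith
  qed
  define B where "B x y = (q (x + y) - q (x - y)) / 4" for x y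
  have Bsym: "B x y = B y x" for x y by (simp add: B_def qsub[of x y] add.commute)
  have B0: "B 0 y = 0" for y by (simp add: B_def qneg)
  have B1: "B (x + z) y + B (x - z) y = 2 * B x y" for x y z
    using pl[of "x + y" z] pl[of "x - y" z] by (simp add: B_def field_simps)
  have B2: "B (x + x) y = 2 * B x y" for x y using B1[of x x y] by (simp add: B0)
  have Badd: "B (u + v) y = B u y + B v y" for u v y
  proof -
    let ?x = "(1/2) *\<^sub>C (u + v)" and ?z = "(1/2) *\<^sub>C (u - v)"
    have "?x + ?z = (1/2) *\<^sub>C (u + u)" "?x - ?z = (1/2) *\<^sub>C (v + v)" "?x + ?x = u + v"
      by (simp_all add: scaleC_add_right[symmetric] scaleC_diff_right[symmetric] scaleC_half_double)
    then show ?thesis using B1[of ?x ?z y] B2[of ?x y] by (simp add: scaleC_half_double)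
  qed
  have Baddr: "B y (u + v) = B y u + B y v" for u v y using Badd[of u v y] by (simp add: Bsym)
  have Bneg: "B (- x) y = - B x y" for x y using Badd[of x "- x" y] by (simp add: B0)
  have Bnegr: "B y (- x) = - B y x" for x y using Bneg[of x y] by (simp add: Bsym)
  have Bbd: "\<bar>B x y\<bar> \<le> (q x + q y) / 2" for x y
  proof -
    have "\<bar>q (x + y) - q (x - y)\<bar> \<le> 2 * q x + 2 * q y"
      using ple[of x y] pos[of "x + y"] pos[of "x - y"] by linarith
    then show ?thesis by (simp add: B_def field_simps)
  qed
  \<comment> \<open>Additivity together with the bound \<open>Bbd\<close>, uniform for
    \<open>|r| \<le> 1\<close>, does the work of continuity.\<close>
  have Breal: "B (of_real r *\<^sub>C x) y = r * B x y" for r x y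
  proof -
    have "(\<lambda>r. B (of_real r *\<^sub>C x) y) r = r * (\<lambda>r. B (of_real r *\<^sub>C x) y) 1"
    proof (rule additive_bounded_linear)
      show "B (of_real (r + s) *\<^sub>C x) y = B (of_real r *\<^sub>C x) y + B (of_real s *\<^sub>C x) y" for r s
        by (simp add: scaleC_add_left Badd)
      show "\<bar>B (of_real r *\<^sub>C x) y\<bar> \<le> (q x + q y) / 2" if "\<bar>r\<bar> \<le> 1" for r
      proof -
        have "r\<^sup>2 * q x \<le> 1 * q x"
          using that by (intro mult_right_mono pos) (simp add: abs_square_le_1)
        then show ?thesis using Bbd[of "of_real r *\<^sub>C x" y] by (simp add: hom)
      qed
    qed
    then show ?thesis by (simp add: scaleC_one)
  qed
  have Brealr: "B x (of_real r *\<^sub>C y) = r * B x y" for r x y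
    using Breal[of r y x] by (simp add: Bsym)
  have Bi: "B (\<i> *\<^sub>C x) (\<i> *\<^sub>C y) = B x y" for x y
    by (simp add: B_def scaleC_add_right[symmetric] scaleC_diff_right[symmetric] hom)
  have ii: "\<i> *\<^sub>C \<i> *\<^sub>C x = - x" for x :: 'v
    by (simp add: scaleC_scaleC scaleC_minus_left scaleC_one)
  have Bi2: "B x (\<i> *\<^sub>C y) = - B (\<i> *\<^sub>C x) y" for x y
    using Bi[of x "\<i> *\<^sub>C y"] by (simp add: ii Bnegr)
  \<comment> \<open>Antilinearity in \<open>y\<close> forces
    \<open>Im (t x y) = Re (t x (i y))\<close>, so the real part \<open>B\<close> determines the
    form.\<close>
  define t where "t x y = Complex (B x y) (B x (\<i> *\<^sub>C y))" for x y
  have tadd: "t (x + z) y = t x y + t z y" for x y z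
    by (simp add: t_def Badd complex_eq_iff)
  have taddr: "t y (x + z) = t y x + t y z" for x y z
    by (simp add: t_def Baddr scaleC_add_right complex_eq_iff)
  have dec: "c *\<^sub>C x = of_real (Re c) *\<^sub>C x + of_real (Im c) *\<^sub>C \<i> *\<^sub>C x" for c and x :: 'v
    by (simp add: scaleC_scaleC scaleC_add_left[symmetric])
      (metis complex_eq mult.commute)
  have tc: "t (c *\<^sub>C x) y = c * t x y" for c x y
    by (subst dec) (simp add: tadd, simp add: t_def Breal Bi Bi2[of x y] complex_eq_iff)
  have tcr: "t x (c *\<^sub>C y) = cnj c * t x y" for c x y
    apply (subst dec)
    apply (simp add: taddr)
    apply (simp add: t_def complex_eq_iff scaleC_scaleC mult.commute[of \<i>])
    apply (simp add: scaleC_scaleC[symmetric] Brealr ii Bnegr)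
    done
  have txx: "t x x = of_real (q x)" for x
  proof -
    have "B x x = q x" by (simp add: B_def dbl q0)
    moreover have "B x (\<i> *\<^sub>C x) = 0" using Bi2[of x x] by (simp add: Bsym[of "\<i> *\<^sub>C x" x])
    ultimately show ?thesis by (simp add: t_def complex_eq_iff)
  qed
  have "is_form t" unfolding is_form_def using tadd taddr tc tcr txx pos by auto
  moreover have "quad t x = q x" for x by (simp add: quad_def txx)
  ultimately show ?thesis by blast
qed

lemma
  assumes "quadratic_functional q"
  shows is_form_form_of_quad: "is_form (form_of_quad q)"
    and quad_form_of_quad: "quad (form_of_quad q) x = q x"
proof -
  have "\<exists>!t. is_form t \<and> (\<forall>x. quad t x = q x)"
    using form_of_quadratic_functional[OF assms] form_eqI by (metis (no_types, lifting))
  from theI'[OF this] show "is_form (form_of_quad q)" "quad (form_of_quad q) x = q x"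
    by (simp_all add: form_of_quad_def)
qed

section \<open>Parallel sums\<close>

lemma form_scale_form:
  assumes w: "is_form w" and c: "0 \<le> c" shows "is_form (form_scale c w)"
proof -
  have "of_real c * w x x \<in> \<real>\<^sub>\<ge>\<^sub>0" for x
    using c quad_nonneg[OF w, of x] by (simp add: form_self_eq[OF w] flip: of_real_mult)
  then show ?thesis
    by (simp add: is_form_def form_scale_def form_simps[OF w] algebra_simps)
qed

lemma quad_form_scale [simp]: "quad (form_scale c w) x = c * quad w x"
  by (simp add: quad_def form_scale_def)

lemma bdd_below_parallel_sum:
  "is_form t \<Longrightarrow> is_form w \<Longrightarrow> bdd_below (range (\<lambda>y. quad t (x - y) + quad w y))"
  by (rule bdd_belowI[of _ 0]) (auto simp: quad_nonneg)

text \<open>Competitors are transformed along with the points: \<open>y\<close> for \<open>x\<close>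
  and \<open>v\<close> for \<open>z\<close> give \<open>y + v\<close> for \<open>x + z\<close> and
  \<open>y - v\<close> for \<open>x - z\<close>. The infima are then taken in one competitor at a
  time.\<close>

lemma quadratic_functional_parallel_sum:
  assumes t: "is_form (t :: 'a::complex_vector form)" and w: "is_form w"
  shows "quadratic_functional (\<lambda>x. INF y. quad t (x - y) + quad w y)"
proof -
  define q where "q x = (INF y. quad t (x - y) + quad w y)" for x
  have le: "q x \<le> quad t (x - y) + quad w y" for x y
    unfolding q_def by (rule cINF_lower[OF bdd_below_parallel_sum[OF t w]]) simp
  have ge: "m \<le> q x" if "\<And>y. m \<le> quad t (x - y) + quad w y" for m x
    unfolding q_def using that by (intro cINF_greatest) auto
  have pos: "0 \<le> q x" for x by (rule ge) (simp add: quad_nonneg t w)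
  \<comment> \<open>The reverse inequality is this one for \<open>1 / c\<close> at the point
    \<open>c x\<close>.\<close>
  have hom: "(cmod c)\<^sup>2 * q x \<le> q (c *\<^sub>C x)" if "c \<noteq> 0" for c x
  proof (rule ge)
    fix y :: 'a
    have y: "y = c *\<^sub>C (1 / c) *\<^sub>C y" using that by (simp add: scaleC_scaleC scaleC_one)
    have "quad t (c *\<^sub>C x - y) + quad w y
        = (cmod c)\<^sup>2 * (quad t (x - (1 / c) *\<^sub>C y) + quad w ((1 / c) *\<^sub>C y))"
      by (subst (1 2) y)
        (simp only: scaleC_diff_right[symmetric] quad_scaleC[OF t] quad_scaleC[OF w, of c]
          distrib_left)
    then show "(cmod c)\<^sup>2 * q x \<le> quad t (c *\<^sub>C x - y) + quad w y"
      by (simp add: le mult_left_mono)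
  qed
  have "q (c *\<^sub>C x) = (cmod c)\<^sup>2 * q x" for c x
  proof (cases "c = 0")
    case True
    then show ?thesis using le[of 0 0] pos[of 0] by (simp add: t w)
  next
    case False
    have "(cmod (1 / c))\<^sup>2 * q (c *\<^sub>C x) \<le> q ((1 / c) *\<^sub>C c *\<^sub>C x)" using False by (intro hom) simp
    then have "q (c *\<^sub>C x) \<le> (cmod c)\<^sup>2 * q x"
      using False by (simp add: scaleC_scaleC scaleC_one norm_divide power_divide field_simps)
    with hom[OF False, of x] show ?thesis by simp
  qed
  moreover have "q (x + z) + q (x - z) \<le> 2 * q x + 2 * q z" for x z
  proof -
    let ?a = "\<lambda>x y. quad t (x - y) + quad w y"
    have *: "q (x + z) + q (x - z) \<le> 2 * ?a x y + 2 * ?a z v" for y v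
    proof -
      have "?a (x + z) (y + v) + ?a (x - z) (y - v) = 2 * ?a x y + 2 * ?a z v"
        using quad_parallelogram[OF t, of "x - y" "z - v"] quad_parallelogram[OF w, of y v]
        by (simp add: algebra_simps)
      then show ?thesis using le[of "x + z" "y + v"] le[of "x - z" "y - v"] by linarith
    qed
    have "(q (x + z) + q (x - z)) / 2 - ?a x y \<le> ?a z v" for y v
      using *[of y v] by (simp add: field_simps)
    then have "(q (x + z) + q (x - z)) / 2 - ?a x y \<le> q z" for y by (rule ge)
    then have "(q (x + z) + q (x - z)) / 2 - q z \<le> ?a x y" for y
      by (simp add: algebra_simps)
    then have "(q (x + z) + q (x - z)) / 2 - q z \<le> q x" by (rule ge)
    then show ?thesis by (simp add: field_simps)
  qed
  ultimately show ?thesis using pos unfolding quadratic_functional_def q_def by blast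
qed

lemma
  assumes t: "is_form t" and w: "is_form w"
  shows is_form_parallel_sum: "is_form (parallel_sum t w)"
    and quad_parallel_sum_le: "quad (parallel_sum t w) x \<le> quad t (x - y) + quad w y"
    and quad_parallel_sum_approx:
      "0 < e \<Longrightarrow> \<exists>y. quad t (x - y) + quad w y < quad (parallel_sum t w) x + e"
    and quad_parallel_sum_greatest:
      "(\<And>y. m \<le> quad t (x - y) + quad w y) \<Longrightarrow> m \<le> quad (parallel_sum t w) x"
proof -
  note q = quadratic_functional_parallel_sum[OF t w]
  show "is_form (parallel_sum t w)"
    unfolding parallel_sum_def by (rule is_form_form_of_quad[OF q])
  have eq: "quad (parallel_sum t w) x = (INF y. quad t (x - y) + quad w y)"
    unfolding parallel_sum_def by (rule quad_form_of_quad[OF q])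
  show "quad (parallel_sum t w) x \<le> quad t (x - y) + quad w y"
    unfolding eq by (rule cINF_lower[OF bdd_below_parallel_sum[OF t w]]) simp
  show "\<exists>y. quad t (x - y) + quad w y < quad (parallel_sum t w) x + e" if "0 < e"
    using that cINF_less_iff[OF _ bdd_below_parallel_sum[OF t w, of x],
        of "quad (parallel_sum t w) x + e"]
    by (simp add: eq)
  show "m \<le> quad (parallel_sum t w) x" if "\<And>y. m \<le> quad t (x - y) + quad w y"
    unfolding eq using that by (intro cINF_greatest) auto
qed

abbreviation psum :: "'v::complex_vector form \<Rightarrow> 'v form \<Rightarrow> nat \<Rightarrow> 'v form" where
  "psum t w n \<equiv> parallel_sum t (form_scale (real n) w)"

lemma
  assumes t: "is_form t" and w: "is_form w"
  shows is_form_psum: "is_form (psum t w n)"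
    and quad_psum_le: "quad (psum t w n) x \<le> quad t (x - y) + real n * quad w y"
    and quad_psum_le_left: "quad (psum t w n) x \<le> quad t x"
    and quad_psum_le_right: "quad (psum t w n) x \<le> real n * quad w x"
    and incseq_quad_psum: "incseq (\<lambda>n. quad (psum t w n) x)"
proof -
  have s: "is_form (form_scale (real n) w)" for n by (simp add: form_scale_form w)
  show "is_form (psum t w n)" by (rule is_form_parallel_sum[OF t s])
  have le: "quad (psum t w n) x \<le> quad t (x - y) + real n * quad w y" for n y
    using quad_parallel_sum_le[OF t s, of n x y] by simp
  then show "quad (psum t w n) x \<le> quad t (x - y) + real n * quad w y" .
  show "quad (psum t w n) x \<le> quad t x" using le[of n 0] by (simp add: t w)
  show "quad (psum t w n) x \<le> real n * quad w x" using le[of n x] by (simp add: t w)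
  show "incseq (\<lambda>n. quad (psum t w n) x)"
  proof (intro incseq_SucI quad_parallel_sum_greatest[OF t s])
    fix n y
    show "quad (psum t w n) x \<le> quad t (x - y) + quad (form_scale (real (Suc n)) w) y"
      using le[of n y] quad_nonneg[OF w, of y] by (simp add: algebra_simps)
  qed
qed

text \<open>Homogeneity and the parallelogram law are closed conditions, so they pass to the limit
  of the increasing sequence of parallel sums; this makes the description by
  \<open>form_of_quad\<close> legitimate.\<close>

lemma
  assumes t: "is_form t" and w: "is_form w"
  shows is_form_form_D: "is_form (form_D w t)"
    and quad_psum_tendsto: "(\<lambda>n. quad (psum t w n) x) \<longlonglongrightarrow> quad (form_D w t) x"
    and quad_psum_le_form_D: "quad (psum t w n) x \<le> quad (form_D w t) x"
    and quad_form_D_le: "quad (form_D w t) x \<le> quad t x"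
    and quad_form_D_least: "(\<And>n. quad (psum t w n) x \<le> m) \<Longrightarrow> quad (form_D w t) x \<le> m"
proof -
  define q where "q x = (SUP n. quad (psum t w n) x)" for x
  note p = is_form_psum[OF t w]
  have bdd: "bdd_above (range (\<lambda>n. quad (psum t w n) x))" for x
    by (rule bdd_aboveI[of _ "quad t x"]) (auto intro: quad_psum_le_left[OF t w])
  have lim: "(\<lambda>n. quad (psum t w n) x) \<longlonglongrightarrow> q x" for x
    unfolding q_def by (rule LIMSEQ_incseq_SUP[OF bdd incseq_quad_psum[OF t w]])
  have qf: "quadratic_functional q"
    unfolding quadratic_functional_def
  proof (intro conjI allI)
    show "0 \<le> q x" for x
      by (rule tendsto_lowerbound[OF lim]) (auto simp: quad_nonneg[OF p])
    show "q (c *\<^sub>C x) = (cmod c)\<^sup>2 * q x" for c x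
      using lim[of "c *\<^sub>C x"] tendsto_mult_left[OF lim[of x], of "(cmod c)\<^sup>2"]
      by (simp add: quad_scaleC[OF p] LIMSEQ_unique)
    show "q (x + y) + q (x - y) \<le> 2 * q x + 2 * q y" for x y
      by (rule tendsto_le[OF _ tendsto_add[OF tendsto_mult_left[OF lim] tendsto_mult_left[OF lim]]
            tendsto_add[OF lim lim]])
        (simp_all add: quad_parallelogram[OF p])
  qed
  show "is_form (form_D w t)"
    using is_form_form_of_quad[OF qf] by (simp add: form_D_def q_def[abs_def])
  have eq: "quad (form_D w t) x = q x"
    using quad_form_of_quad[OF qf] by (simp add: form_D_def q_def[abs_def])
  show "(\<lambda>n. quad (psum t w n) x) \<longlonglongrightarrow> quad (form_D w t) x"
    using lim by (simp add: eq)
  show "quad (psum t w n) x \<le> quad (form_D w t) x"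
    unfolding eq q_def by (rule cSUP_upper[OF _ bdd]) simp
  show least: "quad (form_D w t) x \<le> m" if "\<And>n. quad (psum t w n) x \<le> m" for m
    unfolding eq q_def using that by (intro cSUP_least) auto
  show "quad (form_D w t) x \<le> quad t x"
    by (rule least) (rule quad_psum_le_left[OF t w])
qed

section \<open>Approximation along null sequences\<close>

lemma form_cauchy_iff:
  assumes "is_form t"
  shows "form_cauchy t x \<longleftrightarrow> (\<forall>e>0. \<exists>N. \<forall>m\<ge>N. \<forall>n\<ge>N. quad t (x n - x m) < e)"
  unfolding form_cauchy_def tendsto_iff eventually_prod_sequentially
  by (simp add: quad_nonneg[OF assms])

lemma form_cauchy_mono:
  assumes t: "is_form t" and s: "is_form s"
    and le: "\<And>x. quad s x \<le> c * quad t x" and x: "form_cauchy t x"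
  shows "form_cauchy s x"
  unfolding form_cauchy_iff[OF s]
proof (intro allI impI)
  fix e :: real assume "0 < e"
  \<comment> \<open>Here \<open>c\<close> may be zero or negative, hence the divisor
    \<open>|c| + 1\<close>.\<close>
  then have "0 < e / (\<bar>c\<bar> + 1)" by simp
  then obtain N where N: "\<forall>m\<ge>N. \<forall>n\<ge>N. quad t (x n - x m) < e / (\<bar>c\<bar> + 1)"
    using x unfolding form_cauchy_iff[OF t] by blast
  have "quad s z < e" if "quad t z < e / (\<bar>c\<bar> + 1)" for z
  proof -
    have "c * quad t z \<le> (\<bar>c\<bar> + 1) * quad t z"
      by (intro mult_right_mono quad_nonneg[OF t]) simp
    moreover have "(\<bar>c\<bar> + 1) * quad t z < e" using that by (simp add: field_simps)
    ultimately show ?thesis using le[of z] by linarith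
  qed
  with N show "\<exists>N. \<forall>m\<ge>N. \<forall>n\<ge>N. quad s (x n - x m) < e" by blast
qed

lemma quad_tendsto_mono:
  assumes s: "is_form s" and le: "\<And>x. quad s x \<le> c * quad w x"
    and w0: "(\<lambda>n. quad w (g n)) \<longlonglongrightarrow> 0"
  shows "(\<lambda>n. quad s (g n)) \<longlonglongrightarrow> 0"
proof (rule tendsto_sandwich[OF _ _ tendsto_const])
  show "(\<lambda>n. c * quad w (g n)) \<longlonglongrightarrow> 0" using tendsto_mult_left[OF w0, of c] by simp
qed (auto simp: quad_nonneg[OF s] le)

text \<open>The reverse triangle inequality for the seminorm \<open>sqrt (quad s _)\<close>.\<close>

lemma quad_diff_tendsto:
  assumes s: "is_form s" and g: "(\<lambda>n. quad s (g n)) \<longlonglongrightarrow> 0"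
  shows "(\<lambda>n. quad s (f - g n)) \<longlonglongrightarrow> quad s f"
proof -
  have "(\<lambda>n. sqrt (quad s (g n))) \<longlonglongrightarrow> 0" using tendsto_real_sqrt[OF g] by simp
  then have "(\<lambda>n. sqrt (quad s (f - g n)) - sqrt (quad s f)) \<longlonglongrightarrow> 0"
  proof (rule Lim_null_comparison[rotated])
    show "\<forall>\<^sub>F n in sequentially.
        norm (sqrt (quad s (f - g n)) - sqrt (quad s f)) \<le> sqrt (quad s (g n))"
      using sqrt_quad_diff[OF s, of "f - g n" f for n] by (simp add: quad_minus[OF s])
  qed
  then have "(\<lambda>n. sqrt (quad s (f - g n))) \<longlonglongrightarrow> sqrt (quad s f)" by (simp add: LIM_zero_iff)
  from tendsto_power[OF this, of 2] show ?thesis by (simp add: quad_nonneg[OF s])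
qed

text \<open>Only the real seminorms converge, not the vectors \<open>g n\<close>. This gives
  \<open>lim\<close> its intended meaning in the first formula.\<close>

lemma form_cauchy_convergent:
  assumes t: "is_form t" and c: "form_cauchy t g"
  shows "convergent (\<lambda>n. quad t (f - g n))"
proof -
  have "Cauchy (\<lambda>n. sqrt (quad t (f - g n)))"
  proof (rule metric_CauchyI)
    fix e :: real assume e: "0 < e"
    then obtain N where N: "\<forall>m\<ge>N. \<forall>n\<ge>N. quad t (g n - g m) < e\<^sup>2"
      using c unfolding form_cauchy_iff[OF t] by (meson zero_less_power)
    have "dist (sqrt (quad t (f - g m))) (sqrt (quad t (f - g n))) < e"
      if "m \<ge> N" "n \<ge> N" for m n
    proof -
      have "sqrt (quad t (g n - g m)) < e"
        using N that e by (intro real_less_lsqrt) auto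
      then show ?thesis
        using sqrt_quad_diff[OF t, of "f - g m" "f - g n"] by (simp add: dist_real_def)
    qed
    then show "\<exists>N. \<forall>m\<ge>N. \<forall>n\<ge>N. dist (sqrt (quad t (f - g m))) (sqrt (quad t (f - g n))) < e"
      by blast
  qed
  then obtain l where "(\<lambda>n. sqrt (quad t (f - g n))) \<longlonglongrightarrow> l"
    using Cauchy_convergent convergent_def by blast
  from tendsto_power[OF this, of 2] show ?thesis
    by (auto simp: quad_nonneg[OF t] convergent_def)
qed

text \<open>A single parallel sum already exceeds \<open>a\<close> at \<open>f\<close>. Being
  bounded by \<open>k w\<close>, it is continuous along \<open>w\<close>-null sequences, and it lies
  below \<open>D\<close>.\<close>

lemma form_D_lower_semicontinuous:
  assumes t: "is_form t" and w: "is_form w"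
    and g: "(\<lambda>n. quad w (g n)) \<longlonglongrightarrow> 0" and a: "a < quad (form_D w t) f"
  shows "\<forall>\<^sub>F n in sequentially. a < quad (form_D w t) (f - g n)"
proof -
  obtain k where k: "a < quad (psum t w k) f"
    using quad_form_D_least[OF t w] a by (meson not_less)
  have "(\<lambda>n. quad (psum t w k) (g n)) \<longlonglongrightarrow> 0"
    by (rule quad_tendsto_mono[OF is_form_psum[OF t w] quad_psum_le_right[OF t w] g])
  then have "(\<lambda>n. quad (psum t w k) (f - g n)) \<longlonglongrightarrow> quad (psum t w k) f"
    by (rule quad_diff_tendsto[OF is_form_psum[OF t w]])
  from order_tendstoD(1)[OF this k] show ?thesis
    by eventually_elim (use quad_psum_le_form_D[OF t w] in \<open>blast intro: less_le_trans\<close>)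
qed

text \<open>Near-minimizers of \<open>y \<mapsto> t[f - y] + n w[y]\<close> form a \<open>t\<close>-Cauchy sequence: compare the value
  at the midpoint of two of them with the infimum.\<close>

lemma form_D_recovery_sequence:
  assumes t: "is_form t" and w: "is_form w"
  obtains g where "form_cauchy t g" "(\<lambda>n. quad w (g n)) \<longlonglongrightarrow> 0"
    "(\<lambda>n. quad t (f - g n)) \<longlonglongrightarrow> quad (form_D w t) f"
proof -
  define P where "P n = quad (psum t w n) f" for n
  define d where "d = quad (form_D w t) f"
  \<comment> \<open>Slack for infima that need not be attained.\<close>
  define e where "e n = inverse (real (Suc n))" for n
  have Pd: "P \<longlonglongrightarrow> d" unfolding P_def d_def by (rule quad_psum_tendsto[OF t w])
  have Ple: "P n \<le> d" for n unfolding P_def d_def by (rule quad_psum_le_form_D[OF t w])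
  have e0: "e \<longlonglongrightarrow> 0" unfolding e_def by (rule LIMSEQ_inverse_real_of_nat)
  have epos: "0 < e n" "e n \<le> 1" for n by (auto simp: e_def field_simps)
  have "\<forall>n. \<exists>y. quad t (f - y) + real n * quad w y < P n + e n"
    using quad_parallel_sum_approx[OF t form_scale_form[OF w]] epos(1) unfolding P_def by simp
  then obtain g where g: "\<And>n. quad t (f - g n) + real n * quad w (g n) < P n + e n" by metis
  have lo: "P n \<le> quad t (f - y) + real n * quad w y" for n y
    unfolding P_def by (rule quad_psum_le[OF t w])
  have w0: "(\<lambda>n. quad w (g n)) \<longlonglongrightarrow> 0"
  proof (rule tendsto_sandwich[OF _ _ tendsto_const])
    show "(\<lambda>n. (d + 1) * inverse (real n)) \<longlonglongrightarrow> 0"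
      using tendsto_mult_left[OF lim_inverse_n, of "d + 1"] by simp
    show "\<forall>\<^sub>F n in sequentially. quad w (g n) \<le> (d + 1) * inverse (real n)"
      using eventually_gt_at_top[of 0]
    proof eventually_elim
      case (elim n)
      have "real n * quad w (g n) \<le> d + 1"
        using g[of n] Ple[of n] epos(2)[of n] quad_nonneg[OF t, of "f - g n"] by linarith
      with elim show ?case by (simp add: field_simps)
    qed
  qed (simp add: quad_nonneg[OF w])
  \<comment> \<open>The midpoint is tested in the functional of the smaller index \<open>n\<close>,
    so that \<open>n w[g m]\<close> is at most the penalty \<open>m w[g m]\<close> which
    \<open>g m\<close> has already paid.\<close>
  have gap: "quad t (g n - g m) \<le> 2 * (P m - P n) + 2 * e n + 2 * e m" if "n \<le> m" for n m
  proof -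
    let ?h = "(1/2) *\<^sub>C (g n + g m)"
    have two: "?h + ?h = g n + g m" by (simp add: scaleC_half_double flip: scaleC_add_right)
    have dbl: "quad s (z + z) = 4 * quad s z" if "is_form s" for s and z :: 'a
      using quad_scaleC[OF that, of 2 z] by (simp add: scaleC_two)
    have e: "f - ?h + (f - ?h) = f - g m + (f - g n)" "f - g m - (f - g n) = g n - g m"
      using two by (simp_all add: algebra_simps)
    have a: "4 * quad t (f - ?h) = 2 * quad t (f - g n) + 2 * quad t (f - g m)
        - quad t (g n - g m)"
      using quad_parallelogram[OF t, of "f - g m" "f - g n"] dbl[OF t, of "f - ?h"]
      unfolding e by linarith
    have b: "4 * quad w ?h \<le> 2 * quad w (g n) + 2 * quad w (g m)"
      using quad_le_add[OF w, of "g n" "g m"] dbl[OF w, of ?h] two by simp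
    have "real n * (4 * quad w ?h) \<le> real n * (2 * quad w (g n) + 2 * quad w (g m))"
      using b by (rule mult_left_mono) simp
    moreover have "real n * quad w (g m) \<le> real m * quad w (g m)"
      using that by (intro mult_right_mono quad_nonneg[OF w]) simp
    ultimately show ?thesis
      using lo[of n ?h] a g[of n] g[of m] by (simp add: distrib_left)
  qed
  have "form_cauchy t g" unfolding form_cauchy_iff[OF t]
  proof (intro allI impI)
    fix r :: real assume r: "0 < r"
    have "\<forall>\<^sub>F n in sequentially. d - r / 8 < P n \<and> e n < r / 8"
      using order_tendstoD(1)[OF Pd, of "d - r / 8"] order_tendstoD(2)[OF e0, of "r / 8"] r
      by (simp add: eventually_conj)
    then obtain N where N: "\<And>n. n \<ge> N \<Longrightarrow> d - r / 8 < P n \<and> e n < r / 8"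
      by (auto simp: eventually_sequentially)
    have *: "quad t (g n - g m) < r" if "N \<le> n" "n \<le> m" for n m
      using gap[of n m] N[of n] N[of m] Ple[of m] that by auto
    have "quad t (g n - g m) < r" if "m \<ge> N" "n \<ge> N" for m n
      using that *[of n m] *[of m n] quad_minus_commute[OF t, of "g n" "g m"]
      by (cases "n \<le> m") auto
    then show "\<exists>N. \<forall>m\<ge>N. \<forall>n\<ge>N. quad t (g n - g m) < r" by blast
  qed
  \<comment> \<open>The penalty \<open>n w[g n]\<close> is so far only known to be bounded, so
    near-minimality gives the upper estimate alone; the lower one comes from semicontinuity of
    \<open>D\<close> and \<open>D \<le> t\<close>.\<close>
  moreover have "(\<lambda>n. quad t (f - g n)) \<longlonglongrightarrow> d"
  proof (rule order_tendstoI)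
    fix a assume "a < d"
    from form_D_lower_semicontinuous[OF t w w0 this[unfolded d_def]]
    show "\<forall>\<^sub>F n in sequentially. a < quad t (f - g n)"
      by eventually_elim (use quad_form_D_le[OF t w] in \<open>blast intro: less_le_trans\<close>)
  next
    fix a assume "d < a"
    then have "\<forall>\<^sub>F n in sequentially. e n < a - d" using order_tendstoD(2)[OF e0] by simp
    then show "\<forall>\<^sub>F n in sequentially. quad t (f - g n) < a"
    proof eventually_elim
      case (elim n)
      have "0 \<le> real n * quad w (g n)" by (simp add: quad_nonneg[OF w])
      with g[of n] Ple[of n] elim show ?case by linarith
    qed
  qed
  ultimately show thesis using that[of g] w0 by (simp add: d_def)
qed

section \<open>Differences of forms and a sequential criterion for singularity\<close>

lemma quad_form_diff: "quad (\<lambda>x y. t x y - s x y) x = quad t x - quad s x"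
  by (simp add: quad_def)

lemma is_form_diff:
  assumes t: "is_form t" and s: "is_form s" and le: "form_le s t"
  shows "is_form (\<lambda>x y. t x y - s x y)"
proof -
  have "t x x - s x x \<in> \<real>\<^sub>\<ge>\<^sub>0" for x
    using le by (simp add: form_self_eq[OF t] form_self_eq[OF s] form_le_def
        flip: of_real_diff)
  then show ?thesis
    by (simp add: is_form_def form_simps[OF t] form_simps[OF s] algebra_simps)
qed

lemma form_eq_zeroI:
  assumes s: "is_form s" and "\<And>x. quad s x = 0" shows "s = (\<lambda>x y. 0)"
proof (intro ext)
  fix x y show "s x y = 0" using form_cauchy_schwarz[OF s, of x y] assms(2) by simp
qed

text \<open>For a common minorant \<open>s\<close>, the values \<open>s[f - h n]\<close> tend to
  \<open>s[f]\<close> because \<open>s \<le> w\<close>, and to 0 because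
  \<open>s \<le> t\<close>.\<close>

lemma form_singularI:
  assumes t: "is_form t"
    and ex: "\<And>f. \<exists>h. (\<lambda>n. quad w (h n)) \<longlonglongrightarrow> 0 \<and> (\<lambda>n. quad t (f - h n)) \<longlonglongrightarrow> 0"
  shows "form_singular t w"
  unfolding form_singular_def
proof (intro allI impI, elim conjE)
  fix s assume s: "is_form s" and st: "form_le s t" and sw: "form_le s w"
  show "s = (\<lambda>x y. 0)"
  proof (rule form_eq_zeroI[OF s])
    fix f
    obtain h where h: "(\<lambda>n. quad w (h n)) \<longlonglongrightarrow> 0" "(\<lambda>n. quad t (f - h n)) \<longlonglongrightarrow> 0"
      using ex by blast
    have "(\<lambda>n. quad s (h n)) \<longlonglongrightarrow> 0"
      by (rule quad_tendsto_mono[OF s, of 1, OF _ h(1)]) (use sw in \<open>simp add: form_le_def\<close>)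
    then have "(\<lambda>n. quad s (f - h n)) \<longlonglongrightarrow> quad s f" by (rule quad_diff_tendsto[OF s])
    moreover have "(\<lambda>n. quad s (f - h n)) \<longlonglongrightarrow> 0"
      by (rule quad_tendsto_mono[OF s, of 1, OF _ h(2)]) (use st in \<open>simp add: form_le_def\<close>)
    ultimately show "quad s f = 0" by (rule LIMSEQ_unique)
  qed
qed

section \<open>The Lebesgue decomposition of forms\<close>

text \<open>The order of limits matters: \<open>m\<close> tends to infinity for a fixed parallel
  sum, which is bounded by \<open>k w\<close>, and the supremum over \<open>k\<close> is taken
  afterwards. The Cauchy bound for \<open>D\<close> is uniform in \<open>k\<close>.\<close>

lemma form_D_strongly_ac:
  assumes t: "is_form t" and w: "is_form w"
  shows "form_strongly_ac (form_D w t) w"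
  unfolding form_strongly_ac_def
proof (intro allI impI, elim conjE)
  fix x assume c: "form_cauchy (form_D w t) x" and x0: "(\<lambda>n. quad w (x n)) \<longlonglongrightarrow> 0"
  note D = is_form_form_D[OF t w] and p = is_form_psum[OF t w]
  show "(\<lambda>n. quad (form_D w t) (x n)) \<longlonglongrightarrow> 0"
  proof (rule LIMSEQ_I)
    fix r :: real assume "0 < r"
    then have "0 < r / 2" by simp
    then obtain N where N: "\<And>m n. m \<ge> N \<Longrightarrow> n \<ge> N \<Longrightarrow> quad (form_D w t) (x n - x m) < r / 2"
      using c unfolding form_cauchy_iff[OF D] by blast
    have "quad (form_D w t) (x n) \<le> r / 2" if n: "n \<ge> N" for n
    proof (rule quad_form_D_least[OF t w])
      fix k
      have "(\<lambda>m. quad (psum t w k) (x m)) \<longlonglongrightarrow> 0"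
        by (rule quad_tendsto_mono[OF p quad_psum_le_right[OF t w] x0])
      then have lim: "(\<lambda>m. quad (psum t w k) (x n - x m)) \<longlonglongrightarrow> quad (psum t w k) (x n)"
        by (rule quad_diff_tendsto[OF p])
      show "quad (psum t w k) (x n) \<le> r / 2"
      proof (rule tendsto_upperbound[OF lim])
        show "\<forall>\<^sub>F m in sequentially. quad (psum t w k) (x n - x m) \<le> r / 2"
          using eventually_ge_at_top[of N]
        proof eventually_elim
          case (elim m)
          show ?case
            using quad_psum_le_form_D[OF t w, of k "x n - x m"] N[OF elim n] by linarith
        qed
      qed simp
    qed
    then show "\<exists>no. \<forall>n\<ge>no. norm (quad (form_D w t) (x n) - 0) < r"
      using \<open>0 < r\<close> by (intro exI[of _ N]) (fastforce simp: quad_nonneg[OF D])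
  qed
qed

text \<open>Along a recovery sequence \<open>t[f - g n]\<close> and \<open>D[f - g n]\<close> both
  tend to \<open>D[f]\<close>, the latter since absolute continuity makes \<open>D[g n]\<close>
  null. That \<open>D[g n]\<close> is null is recorded because the second decomposition relies on
  it.\<close>

lemma form_D_residual_recovery:
  assumes t: "is_form t" and w: "is_form w"
  obtains g where "(\<lambda>n. quad w (g n)) \<longlonglongrightarrow> 0" "(\<lambda>n. quad (form_D w t) (g n)) \<longlonglongrightarrow> 0"
    "(\<lambda>n. quad (\<lambda>x y. t x y - form_D w t x y) (f - g n)) \<longlonglongrightarrow> 0"
proof -
  note D = is_form_form_D[OF t w]
  obtain g where g: "form_cauchy t g" "(\<lambda>n. quad w (g n)) \<longlonglongrightarrow> 0"
    "(\<lambda>n. quad t (f - g n)) \<longlonglongrightarrow> quad (form_D w t) f"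
    by (rule form_D_recovery_sequence[OF t w])
  have "form_cauchy (form_D w t) g"
    by (rule form_cauchy_mono[OF t D _ g(1), of 1]) (simp add: quad_form_D_le[OF t w])
  then have D0: "(\<lambda>n. quad (form_D w t) (g n)) \<longlonglongrightarrow> 0"
    using form_D_strongly_ac[OF t w] g(2) by (simp add: form_strongly_ac_def)
  show thesis
    using that[OF g(2) D0] tendsto_diff[OF g(3) quad_diff_tendsto[OF D D0, of f]]
    by (simp add: quad_form_diff)
qed

lemma form_le_form_D: "is_form t \<Longrightarrow> is_form w \<Longrightarrow> form_le (form_D w t) t"
  by (simp add: form_le_def quad_form_D_le)

lemma form_D_singular:
  assumes t: "is_form t" and w: "is_form w"
  shows "form_singular (\<lambda>x y. t x y - form_D w t x y) w"
proof (rule form_singularI)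
  show "is_form (\<lambda>x y. t x y - form_D w t x y)"
    by (rule is_form_diff[OF t is_form_form_D[OF t w] form_le_form_D[OF t w]])
  show "\<exists>h. (\<lambda>n. quad w (h n)) \<longlonglongrightarrow> 0 \<and>
      (\<lambda>n. quad (\<lambda>x y. t x y - form_D w t x y) (f - h n)) \<longlonglongrightarrow> 0" for f
    by (rule form_D_residual_recovery[OF t w, of f]) blast
qed

text \<open>Along a recovery sequence, \<open>s[f]\<close> is the limit of
  \<open>s[f - g n] \<le> t[f - g n]\<close>, and the right side tends to
  \<open>D[f]\<close>.\<close>

lemma form_D_greatest:
  assumes t: "is_form t" and w: "is_form w" and s: "is_form s"
    and le: "form_le s t" and ac: "form_strongly_ac s w"
  shows "form_le s (form_D w t)"
  unfolding form_le_def
proof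
  fix f
  obtain g where g: "form_cauchy t g" "(\<lambda>n. quad w (g n)) \<longlonglongrightarrow> 0"
    "(\<lambda>n. quad t (f - g n)) \<longlonglongrightarrow> quad (form_D w t) f"
    by (rule form_D_recovery_sequence[OF t w])
  have le': "quad s x \<le> quad t x" for x using le by (simp add: form_le_def)
  have "form_cauchy s g" by (rule form_cauchy_mono[OF t s _ g(1), of 1]) (simp add: le')
  then have "(\<lambda>n. quad s (g n)) \<longlonglongrightarrow> 0" using ac g(2) by (simp add: form_strongly_ac_def)
  then have "(\<lambda>n. quad s (f - g n)) \<longlonglongrightarrow> quad s f" by (rule quad_diff_tendsto[OF s])
  from LIMSEQ_le[OF this g(3)] le' show "quad s f \<le> quad (form_D w t) f" by blast
qed

lemma form_D_le_liminf:
  assumes t: "is_form t" and w: "is_form w" and g: "(\<lambda>n. quad w (g n)) \<longlonglongrightarrow> 0"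
  shows "ereal (quad (form_D w t) f) \<le> liminf (\<lambda>n. ereal (quad t (f - g n)))"
  unfolding le_Liminf_iff
proof (intro allI impI)
  fix y :: ereal assume y: "y < ereal (quad (form_D w t) f)"
  \<comment> \<open>The bound \<open>y\<close> may be minus infinity, so a real number is inserted
    before semicontinuity is applied.\<close>
  then obtain r where r: "y < ereal r" "ereal r < ereal (quad (form_D w t) f)"
    using ereal_dense2 by blast
  then have "\<forall>\<^sub>F n in sequentially. r < quad (form_D w t) (f - g n)"
    by (intro form_D_lower_semicontinuous[OF t w g]) simp
  then show "\<forall>\<^sub>F n in sequentially. y < ereal (quad t (f - g n))"
  proof eventually_elim
    case (elim n)
    then have "r < quad t (f - g n)" using quad_form_D_le[OF t w, of "f - g n"] by linarith
    with r(1) show ?case by (meson ereal_less_eq(3) less_ereal.simps(1) less_trans)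
  qed
qed

text \<open>A recovery sequence attains the infimum, so the real \<open>Inf\<close> is a
  minimum.\<close>

lemma form_D_eq_Inf_lim:
  assumes t: "is_form t" and w: "is_form w"
  shows "quad (form_D w t) f =
    Inf {lim (\<lambda>n. quad t (f - g n)) | g. form_cauchy t g \<and> (\<lambda>n. quad w (g n)) \<longlonglongrightarrow> 0}"
    (is "_ = Inf ?A")
proof (rule sym, rule cInf_eq_minimum)
  obtain g where g: "form_cauchy t g" "(\<lambda>n. quad w (g n)) \<longlonglongrightarrow> 0"
    "(\<lambda>n. quad t (f - g n)) \<longlonglongrightarrow> quad (form_D w t) f"
    by (rule form_D_recovery_sequence[OF t w])
  show "quad (form_D w t) f \<in> ?A" using g limI[OF g(3)] by force
  fix r assume "r \<in> ?A"
  then obtain g where g: "form_cauchy t g" "(\<lambda>n. quad w (g n)) \<longlonglongrightarrow> 0"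
    and r: "r = lim (\<lambda>n. quad t (f - g n))" by blast
  have "(\<lambda>n. quad t (f - g n)) \<longlonglongrightarrow> r"
    unfolding r using form_cauchy_convergent[OF t g(1)] by (simp add: convergent_LIMSEQ_iff)
  then have "liminf (\<lambda>n. ereal (quad t (f - g n))) = ereal r"
    by (intro lim_imp_Liminf) auto
  with form_D_le_liminf[OF t w g(2), of f] show "quad (form_D w t) f \<le> r" by simp
qed

lemma form_D_eq_Inf_liminf:
  assumes t: "is_form t" and w: "is_form w"
  shows "ereal (quad (form_D w t) f) =
    Inf {liminf (\<lambda>n. ereal (quad t (f - g n))) | g. (\<lambda>n. quad w (g n)) \<longlonglongrightarrow> 0}"
    (is "_ = Inf ?A")
proof (rule antisym)
  show "ereal (quad (form_D w t) f) \<le> Inf ?A"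
    by (rule Inf_greatest) (auto intro: form_D_le_liminf[OF t w])
  obtain g where g: "form_cauchy t g" "(\<lambda>n. quad w (g n)) \<longlonglongrightarrow> 0"
    "(\<lambda>n. quad t (f - g n)) \<longlonglongrightarrow> quad (form_D w t) f"
    by (rule form_D_recovery_sequence[OF t w])
  have "liminf (\<lambda>n. ereal (quad t (f - g n))) = ereal (quad (form_D w t) f)"
    using g(3) by (intro lim_imp_Liminf) auto
  then have "ereal (quad (form_D w t) f) \<in> ?A" using g(2) by force
  then show "Inf ?A \<le> ereal (quad (form_D w t) f)" by (rule Inf_lower)
qed

section \<open>Uniqueness of the decomposition\<close>

text \<open>Maximality gives \<open>t1 \<le> D\<close>, and \<open>D - t1 \<le> t - t1 = t2\<close>.
  If \<open>D\<close> is dominated, a small multiple of \<open>D - t1\<close> lies below both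
  \<open>t2\<close> and \<open>w\<close>, so singularity annihilates it.\<close>

lemma form_decomposition_unique:
  assumes t: "is_form t" and w: "is_form w" and dom: "form_dominated (form_D w t) w"
    and t1: "is_form t1" and t2: "is_form t2" and sum: "\<And>x y. t x y = t1 x y + t2 x y"
    and ac: "form_strongly_ac t1 w" and sing: "form_singular t2 w"
  shows "t1 = form_D w t"
proof -
  note D = is_form_form_D[OF t w]
  have q: "quad t x = quad t1 x + quad t2 x" for x by (simp add: quad_def sum)
  have "form_le t1 t" by (simp add: form_le_def q quad_nonneg[OF t2])
  then have le: "form_le t1 (form_D w t)" by (rule form_D_greatest[OF t w t1 _ ac])
  define s where "s x y = form_D w t x y - t1 x y" for x y
  have s: "is_form s" unfolding s_def[abs_def] by (rule is_form_diff[OF D t1 le])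
  have qs: "quad s x = quad (form_D w t) x - quad t1 x" for x by (simp add: quad_def s_def)
  obtain c where c: "\<And>x. quad (form_D w t) x \<le> c * quad w x"
    using dom by (auto simp: form_dominated_def form_le_def)
  \<comment> \<open>\<open>b \<le> 1\<close> serves the comparison with \<open>t2\<close>, and
    \<open>b (|c| + 1) = 1\<close> the one with \<open>w\<close>.\<close>
  define b where "b = inverse (\<bar>c\<bar> + 1)"
  have b: "0 < b" "b \<le> 1" "b * (\<bar>c\<bar> + 1) = 1" by (auto simp: b_def field_simps)
  have "b * quad s x \<le> quad t2 x" for x
  proof -
    have "b * quad s x \<le> 1 * quad s x" by (intro mult_right_mono b quad_nonneg[OF s])
    then show ?thesis using quad_form_D_le[OF t w, of x] by (simp add: q qs)
  qed
  moreover have "b * quad s x \<le> quad w x" for x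
  proof -
    have "quad s x \<le> (\<bar>c\<bar> + 1) * quad w x"
      using c[of x] quad_nonneg[OF t1, of x] quad_nonneg[OF w, of x]
        mult_right_mono[OF abs_ge_self[of c], of "quad w x"]
      by (simp add: qs distrib_right)
    then have "b * quad s x \<le> b * ((\<bar>c\<bar> + 1) * quad w x)" using b by (intro mult_left_mono) auto
    then show ?thesis using b(3) by (simp add: mult.assoc[symmetric])
  qed
  ultimately have "form_scale b s = (\<lambda>x y. 0)"
    using sing form_scale_form[OF s] b by (simp add: form_singular_def form_le_def)
  then have "quad (form_scale b s) x = 0" for x by (simp add: quad_def)
  then have "quad s x = 0" for x using b by simp
  then show ?thesis using form_eqI[OF t1 D] by (simp add: qs)
qed

text \<open>A gliding hump with signs: each new term of the series defining the functional is given
  the sign for which the partial sum is large at the corresponding point.\<close>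

lemma undominated_functional:
  fixes D w :: "'v::complex_vector form"
  assumes D: "is_form D" and w: "is_form w" and nd: "\<not> form_dominated D w"
  obtains \<phi> u where "\<And>x y. \<phi> (x + y) = \<phi> x + \<phi> y" "\<And>c x. \<phi> (c *\<^sub>C x) = c * \<phi> x"
    "\<And>x. (cmod (\<phi> x))\<^sup>2 \<le> quad D x / 4"
    "\<And>n::nat. \<phi> (u n) = 1" "(\<lambda>n. quad w (u n)) \<longlonglongrightarrow> 0"
proof -
  \<comment> \<open>Failure of domination with the constant \<open>10 ^ n\<close>, rescaled to
    \<open>D[x] = 1\<close>.\<close>
  have "\<exists>x. quad D x = 1 \<and> quad w x \<le> (1/10) ^ n" for n
  proof -
    obtain x where x: "10 ^ n * quad w x < quad D x"
      using nd by (auto simp: form_dominated_def form_le_def not_le)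
    have "0 \<le> 10 ^ n * quad w x" using quad_nonneg[OF w, of x] by simp
    then have pos: "0 < quad D x" using x by linarith
    define a where "a = 1 / sqrt (quad D x)"
    have a: "a\<^sup>2 = 1 / quad D x" using pos by (simp add: a_def power_divide)
    have "quad D (of_real a *\<^sub>C x) = 1" using pos by (simp add: quad_scaleC[OF D] a)
    moreover have "quad w (of_real a *\<^sub>C x) \<le> (1/10) ^ n"
      using x pos by (simp add: quad_scaleC[OF w] a field_simps)
    ultimately show ?thesis by blast
  qed
  then obtain x where x1: "\<And>n. quad D (x n) = 1" and xw: "\<And>n. quad w (x n) \<le> (1/10) ^ n"
    by metis
  \<comment> \<open>The steps after the \<open>n\<close>-th add up to \<open>r n / 2\<close>, so
    half of the gain at \<open>x n\<close> survives. All steps add up to 1/2, whence the bound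
    \<open>D/4\<close>. Dividing by \<open>\<phi> (x n)\<close> costs at most
    \<open>36 * 9 ^ n\<close> in \<open>w\<close>, which \<open>10 ^ n\<close> outweighs.\<close>
  define r :: "nat \<Rightarrow> real" where "r n = (1/3) ^ Suc n" for n
  have rpos: "0 < r n" for n by (simp add: r_def)
  have "\<exists>v. \<forall>n. (n = 0 \<longrightarrow> v n = 0) \<and>
      (sqrt (quad D (v (Suc n) - v n)) \<le> r n \<and> r n \<le> cmod (D (x n) (v (Suc n))))"
  proof (rule dependent_nat_choice)
    fix y n
    let ?a = "\<lambda>s. (s * of_real (r n)) *\<^sub>C x n"
    have "cmod (D (x n) (y + ?a 1) - D (x n) (y + ?a (- 1))) = 2 * r n"
      using rpos[of n]
      by (simp add: form_simps[OF D] scaleC_minus_left form_self_eq[OF D] x1 norm_mult)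
    then have "2 * r n \<le> cmod (D (x n) (y + ?a 1)) + cmod (D (x n) (y + ?a (- 1)))"
      using norm_triangle_ineq4[of "D (x n) (y + ?a 1)" "D (x n) (y + ?a (- 1))"] by simp
    then have "r n \<le> cmod (D (x n) (y + ?a 1)) \<or> r n \<le> cmod (D (x n) (y + ?a (- 1)))"
      by linarith
    then obtain s :: complex where "cmod s = 1" "r n \<le> cmod (D (x n) (y + ?a s))"
      by (metis norm_minus_cancel norm_one)
    moreover have "sqrt (quad D (y + ?a s - y)) \<le> r n" if "cmod s = 1" for s
      using that rpos[of n] by (simp add: quad_scaleC[OF D] x1 norm_mult)
    ultimately show "\<exists>z. (Suc n = 0 \<longrightarrow> z = 0) \<and>
        (sqrt (quad D (z - y)) \<le> r n \<and> r n \<le> cmod (D (x n) z))" by blast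
  qed simp
  then obtain v where v0: "v 0 = 0" and vd: "\<And>n. sqrt (quad D (v (Suc n) - v n)) \<le> r n"
    and vx: "\<And>n. r n \<le> cmod (D (x n) (v (Suc n)))" by blast
  have tail: "sqrt (quad D (v m - v n)) \<le> ((1/3) ^ n - (1/3) ^ m) / 2" if "n \<le> m" for n m
    using that
  proof (induction m rule: dec_induct)
    case base then show ?case by (simp add: D)
  next
    case (step m)
    have "sqrt (quad D (v (Suc m) - v n))
        \<le> sqrt (quad D (v (Suc m) - v m)) + sqrt (quad D (v m - v n))"
      using sqrt_quad_triangle[OF D, of "v (Suc m) - v m" "v m - v n"] by simp
    also have "\<dots> \<le> r m + ((1/3) ^ n - (1/3) ^ m) / 2" using vd[of m] step by linarith
    also have "\<dots> = ((1/3) ^ n - (1/3) ^ Suc m) / 2" by (simp add: r_def field_simps)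
    finally show ?case .
  qed
  have near: "cmod (D y (v m) - D y (v n)) \<le> sqrt (quad D y) * ((1/3) ^ n / 2)"
    if "n \<le> m" for n m y
  proof -
    have "cmod (D y (v m) - D y (v n)) \<le> sqrt (quad D y) * sqrt (quad D (v m - v n))"
      using cmod_form_le[OF D, of y "v m - v n"] by (simp add: form_simps[OF D])
    also have "sqrt (quad D (v m - v n)) \<le> (1/3) ^ n / 2"
      by (rule order_trans[OF tail[OF that]]) simp
    finally show ?thesis by (simp add: mult_left_mono quad_nonneg[OF D])
  qed
  \<comment> \<open>The \<open>v n\<close> are \<open>D\<close>-Cauchy; \<open>\<phi>\<close> is the
    functional that their limit in the completion would represent.\<close>
  define \<phi> where "\<phi> y = lim (\<lambda>n. D y (v n))" for y
  have lim: "(\<lambda>n. D y (v n)) \<longlonglongrightarrow> \<phi> y" for y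
  proof -
    have z: "(\<lambda>n. sqrt (quad D y) * ((1/3) ^ n / 2)) \<longlonglongrightarrow> 0"
      by (rule tendsto_mult_right_zero) (rule tendsto_divide_zero, rule LIMSEQ_power_zero, simp)
    have "Cauchy (\<lambda>n. D y (v n))"
    proof (rule CauchyI')
      fix e :: real assume "0 < e"
      from order_tendstoD(2)[OF z this]
      obtain N where N: "\<And>n. n \<ge> N \<Longrightarrow> sqrt (quad D y) * ((1/3) ^ n / 2) < e"
        by (auto simp: eventually_sequentially)
      have "dist (D y (v m)) (D y (v n)) < e" if "m \<ge> N" "n > m" for m n
        using near[of m n y] N[of m] that by (simp add: dist_norm norm_minus_commute)
      then show "\<exists>M. \<forall>m\<ge>M. \<forall>n>m. dist (D y (v m)) (D y (v n)) < e" by blast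
    qed
    then show ?thesis
      unfolding \<phi>_def using Cauchy_convergent convergent_LIMSEQ_iff by blast
  qed
  have near_lim: "cmod (\<phi> y - D y (v n)) \<le> sqrt (quad D y) * ((1/3) ^ n / 2)" for y n
  proof (rule tendsto_upperbound)
    show "(\<lambda>m. cmod (D y (v m) - D y (v n))) \<longlonglongrightarrow> cmod (\<phi> y - D y (v n))"
      by (intro tendsto_intros lim)
    show "\<forall>\<^sub>F m in sequentially. cmod (D y (v m) - D y (v n)) \<le> sqrt (quad D y) * ((1/3) ^ n / 2)"
      using eventually_ge_at_top[of n] by eventually_elim (rule near)
  qed simp
  have add: "\<phi> (y + z) = \<phi> y + \<phi> z" for y z
    by (rule LIMSEQ_unique[OF lim]) (simp add: form_simps[OF D] tendsto_add lim)
  have scale: "\<phi> (c *\<^sub>C y) = c * \<phi> y" for c y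
    by (rule LIMSEQ_unique[OF lim]) (simp add: form_simps[OF D] tendsto_mult_left lim)
  have "D y 0 = 0" for y using form_scaleC_right[OF D, of y 0 0] by simp
  then have "cmod (\<phi> y) \<le> sqrt (quad D y) / 2" for y
    using near_lim[of y 0] by (simp add: v0)
  then have bound: "(cmod (\<phi> y))\<^sup>2 \<le> quad D y / 4" for y
    using power_mono[of "cmod (\<phi> y)" "sqrt (quad D y) / 2" 2]
    by (simp add: power_divide quad_nonneg[OF D])
  \<comment> \<open>The estimate \<open>near_lim\<close> at \<open>Suc n\<close> loses at most
    \<open>r n / 2\<close> of the modulus \<open>r n\<close> secured when \<open>v (Suc n)\<close>
    was chosen.\<close>
  have big: "r n / 2 \<le> cmod (\<phi> (x n))" for n
    using near_lim[of "x n" "Suc n"] vx[of n] x1[of n]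
      norm_triangle_ineq2[of "D (x n) (v (Suc n))" "\<phi> (x n)"]
    by (simp add: r_def norm_minus_commute)
  have nz: "\<phi> (x n) \<noteq> 0" for n using big[of n] rpos[of n] by auto
  define u where "u n = inverse (\<phi> (x n)) *\<^sub>C x n" for n
  have u1: "\<phi> (u n) = 1" for n by (simp add: u_def scale nz)
  have uw: "(\<lambda>n. quad w (u n)) \<longlonglongrightarrow> 0"
  proof (rule tendsto_sandwich[OF _ _ tendsto_const])
    show "(\<lambda>n. 36 * (9/10) ^ n :: real) \<longlonglongrightarrow> 0"
      by (rule tendsto_mult_right_zero) (rule LIMSEQ_power_zero, simp)
    have "quad w (u n) \<le> 36 * (9/10) ^ n" for n
    proof -
      have "inverse (cmod (\<phi> (x n))) \<le> inverse (r n / 2)"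
        using big[of n] rpos[of n] by (intro le_imp_inverse_le) auto
      then have "(cmod (inverse (\<phi> (x n))))\<^sup>2 \<le> (inverse (r n / 2))\<^sup>2"
        by (intro power_mono) (simp_all add: norm_inverse)
      also have "\<dots> = 36 * 9 ^ n"
        by (simp add: r_def power_mult_distrib power_divide power_inverse[symmetric]
            power_mult[symmetric] mult.commute[of n] power_mult)
      finally have "quad w (u n) \<le> (36 * 9 ^ n) * (1/10) ^ n"
        unfolding u_def quad_scaleC[OF w] by (intro mult_mono xw quad_nonneg[OF w]) auto
      then show ?thesis by (simp add: power_divide)
    qed
    then show "\<forall>\<^sub>F n in sequentially. quad w (u n) \<le> 36 * (9/10) ^ n" by simp
  qed (simp add: quad_nonneg[OF w])
  show thesis by (rule that[OF add scale bound u1 uw])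
qed

text \<open>Moving the rank-one form \<open>|\<phi>|\<^sup>2\<close> from the absolutely continuous part to the singular part:
  \<open>D - |\<phi>|\<^sup>2\<close> is equivalent to \<open>D\<close>, and \<open>|\<phi>|\<^sup>2\<close> stays singular as \<open>\<phi>\<close> is not \<open>w\<close>-bounded.\<close>

lemma form_decomposition_not_unique:
  fixes t w :: "'v::complex_vector form"
  assumes t: "is_form t" and w: "is_form w" and nd: "\<not> form_dominated (form_D w t) w"
  obtains t1 where "is_form t1" "form_le t1 t" "form_strongly_ac t1 w"
    "form_singular (\<lambda>x y. t x y - t1 x y) w" "t1 \<noteq> form_D w t"
proof -
  note D = is_form_form_D[OF t w]
  obtain \<phi> u where add: "\<And>x y. \<phi> (x + y) = \<phi> x + \<phi> y" and scale: "\<And>c x. \<phi> (c *\<^sub>C x) = c * \<phi> x"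
    and bound: "\<And>x. (cmod (\<phi> x))\<^sup>2 \<le> quad (form_D w t) x / 4"
    and u1: "\<And>n::nat. \<phi> (u n) = 1" and uw: "(\<lambda>n. quad w (u n)) \<longlonglongrightarrow> 0"
    using undominated_functional[OF D w nd] by blast
  define s where "s x y = \<phi> x * cnj (\<phi> y)" for x y
  have sxx: "s x x = of_real ((cmod (\<phi> x))\<^sup>2)" for x by (simp only: s_def complex_norm_square)
  have s: "is_form s"
    by (simp add: is_form_def sxx) (simp add: s_def add scale algebra_simps)
  have qs: "quad s x = (cmod (\<phi> x))\<^sup>2" for x by (simp add: quad_def sxx)
  have sD: "quad s x \<le> quad (form_D w t) x / 4" for x using bound[of x] by (simp only: qs)
  have "quad s x \<le> quad (form_D w t) x" for x
    using sD[of x] quad_nonneg[OF D, of x] by linarith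
  then have "form_le s (form_D w t)" by (simp add: form_le_def)
  define t1 where "t1 x y = form_D w t x y - s x y" for x y
  have t1: "is_form t1" unfolding t1_def[abs_def] by (rule is_form_diff[OF D s]) fact
  have q1: "quad t1 x = quad (form_D w t) x - quad s x" for x by (simp add: quad_def t1_def)
  have "quad t1 x \<le> quad t x" for x
    using quad_form_D_le[OF t w, of x] quad_nonneg[OF s, of x] by (simp add: q1)
  then have le: "form_le t1 t" by (simp add: form_le_def)
  have ac: "form_strongly_ac t1 w"
    unfolding form_strongly_ac_def
  proof (intro allI impI, elim conjE)
    fix x assume x: "form_cauchy t1 x" "(\<lambda>n. quad w (x n)) \<longlonglongrightarrow> 0"
    \<comment> \<open>\<open>t1 \<ge> 3/4 D\<close> by the bound on \<open>\<phi>\<close>; the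
      factor 2 is generous.\<close>
    have "quad (form_D w t) y \<le> 2 * quad t1 y" for y
      using sD[of y] quad_nonneg[OF D, of y] by (simp add: q1)
    then have "form_cauchy (form_D w t) x" by (rule form_cauchy_mono[OF t1 D _ x(1)])
    then have "(\<lambda>n. quad (form_D w t) (x n)) \<longlonglongrightarrow> 0"
      using form_D_strongly_ac[OF t w] x(2) by (simp add: form_strongly_ac_def)
    then show "(\<lambda>n. quad t1 (x n)) \<longlonglongrightarrow> 0"
      by (rule quad_tendsto_mono[OF t1, of 1, rotated]) (simp add: q1 quad_nonneg[OF s])
  qed
  define p where "p x y = t x y - form_D w t x y" for x y
  have p: "is_form p"
    unfolding p_def[abs_def] by (rule is_form_diff[OF t D form_le_form_D[OF t w]])
  have rec: "\<exists>g. (\<lambda>n. quad w (g n)) \<longlonglongrightarrow> 0 \<and> (\<lambda>n. \<phi> (g n)) \<longlonglongrightarrow> 0 \<and>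
      (\<lambda>n. quad p (f - g n)) \<longlonglongrightarrow> 0" for f
  proof -
    obtain g where g: "(\<lambda>n. quad w (g n)) \<longlonglongrightarrow> 0" "(\<lambda>n. quad (form_D w t) (g n)) \<longlonglongrightarrow> 0"
      "(\<lambda>n. quad p (f - g n)) \<longlonglongrightarrow> 0"
      unfolding p_def[abs_def] by (rule form_D_residual_recovery[OF t w, of f])
    have "(\<lambda>n. quad s (g n)) \<longlonglongrightarrow> 0"
      by (rule quad_tendsto_mono[OF s, of "1/4", OF _ g(2)]) (use sD in simp)
    then have "(\<lambda>n. sqrt ((cmod (\<phi> (g n)))\<^sup>2)) \<longlonglongrightarrow> sqrt 0"
      unfolding qs by (rule tendsto_real_sqrt)
    then have "(\<lambda>n. \<phi> (g n)) \<longlonglongrightarrow> 0" by (simp add: tendsto_norm_zero_iff)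
    with g show ?thesis by blast
  qed
  \<comment> \<open>A diagonal choice: \<open>h n\<close> is a late term of the recovery sequence
    for the point \<open>u n\<close>. The difference \<open>k n = u n - h n\<close> is then null for
    \<open>w\<close> and \<open>p\<close>, while \<open>\<phi> (k n)\<close> tends to 1.\<close>
  have "\<exists>h. quad w h < inverse (Suc n) \<and> cmod (\<phi> h) < inverse (Suc n) \<and>
      quad p (u n - h) < inverse (Suc n)" for n
  proof -
    obtain g where g: "(\<lambda>n. quad w (g n)) \<longlonglongrightarrow> 0" "(\<lambda>n. \<phi> (g n)) \<longlonglongrightarrow> 0"
      "(\<lambda>k. quad p (u n - g k)) \<longlonglongrightarrow> 0" using rec by blast
    have i: "0 < inverse (real (Suc n))" by simp
    have "\<forall>\<^sub>F k in sequentially. quad w (g k) < inverse (Suc n) \<and>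
        cmod (\<phi> (g k)) < inverse (Suc n) \<and> quad p (u n - g k) < inverse (Suc n)"
      using order_tendstoD(2)[OF g(1) i] order_tendstoD(2)[OF tendsto_norm_zero[OF g(2)] i]
        order_tendstoD(2)[OF g(3) i] by eventually_elim simp
    then show ?thesis using eventually_happens by fastforce
  qed
  then obtain h where h: "\<And>n. quad w (h n) < inverse (Suc n)"
    "\<And>n. cmod (\<phi> (h n)) < inverse (Suc n)" "\<And>n. quad p (u n - h n) < inverse (Suc n)"
    by metis
  have null: "a \<longlonglongrightarrow> 0" if "\<And>n. norm (a n) < inverse (Suc n)" for a :: "nat \<Rightarrow> 'b::real_normed_vector"
    by (rule Lim_null_comparison[OF _ LIMSEQ_inverse_real_of_nat])
      (intro always_eventually allI less_imp_le that)
  define k where "k n = u n - h n" for n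
  have "(\<lambda>n. quad w (h n)) \<longlonglongrightarrow> 0" using h(1) by (intro null) (simp add: quad_nonneg[OF w])
  then have "(\<lambda>n. 2 * quad w (u n) + 2 * quad w (h n)) \<longlonglongrightarrow> 0"
    using tendsto_add[OF tendsto_mult_left[OF uw, of 2] tendsto_mult_left[of _ 0 _ 2]] by force
  then have kw: "(\<lambda>n. quad w (k n)) \<longlonglongrightarrow> 0"
    by (rule tendsto_sandwich[OF _ _ tendsto_const, rotated 2])
      (auto simp: quad_nonneg[OF w] k_def quad_le_diff[OF w])
  have kp: "(\<lambda>n. quad p (k n)) \<longlonglongrightarrow> 0"
    unfolding k_def using h(3) by (intro null) (simp add: quad_nonneg[OF p])
  have minus: "\<phi> (x - y) = \<phi> x - \<phi> y" for x y using add[of "x - y" y] by (simp add: algebra_simps)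
  have "(\<lambda>n. \<phi> (h n)) \<longlonglongrightarrow> 0" using h(2) by (rule null)
  then have k\<phi>: "(\<lambda>n. \<phi> (k n)) \<longlonglongrightarrow> 1"
    unfolding k_def minus u1 using tendsto_diff[OF tendsto_const, of _ 0 _ 1] by force
  define t2 where "t2 x y = t x y - t1 x y" for x y
  have q2: "quad t2 x = quad p x + (cmod (\<phi> x))\<^sup>2" for x
    unfolding qs[symmetric] by (simp add: quad_def t2_def p_def t1_def)
  have "form_singular t2 w"
  proof (rule form_singularI)
    show "is_form t2" unfolding t2_def[abs_def] by (rule is_form_diff[OF t t1 le])
    fix f
    obtain g where g: "(\<lambda>n. quad w (g n)) \<longlonglongrightarrow> 0" "(\<lambda>n. \<phi> (g n)) \<longlonglongrightarrow> 0"
      "(\<lambda>n. quad p (f - g n)) \<longlonglongrightarrow> 0" using rec by blast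
    \<comment> \<open>Since \<open>\<phi> (g n)\<close> tends to 0, the sequence \<open>g\<close>
      leaves \<open>\<phi> (f - g n)\<close> near \<open>\<phi> f\<close>; the added multiple of
      \<open>k n\<close> cancels this value.\<close>
    define b where "b n = g n + \<phi> f *\<^sub>C k n" for n
    let ?c = "(cmod (\<phi> f))\<^sup>2"
    have lim2: "(\<lambda>n. 2 * X n + 2 * (?c * Y n)) \<longlonglongrightarrow> 0" if "X \<longlonglongrightarrow> 0" "Y \<longlonglongrightarrow> 0"
      for X Y :: "nat \<Rightarrow> real"
      using tendsto_add[OF tendsto_mult_left[OF that(1), of 2]
          tendsto_mult_left[OF tendsto_mult_left[OF that(2), of ?c], of 2]] by simp
    have "quad w (b n) \<le> 2 * quad w (g n) + 2 * (?c * quad w (k n))" for n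
      using quad_le_add[OF w, of "g n" "\<phi> f *\<^sub>C k n"] by (simp add: b_def quad_scaleC[OF w])
    then have bw: "(\<lambda>n. quad w (b n)) \<longlonglongrightarrow> 0"
      by (intro tendsto_sandwich[OF _ _ tendsto_const lim2[OF g(1) kw]])
        (auto simp: quad_nonneg[OF w])
    have "quad p (f - b n) \<le> 2 * quad p (f - g n) + 2 * (?c * quad p (k n))" for n
      using quad_le_diff[OF p, of "f - g n" "\<phi> f *\<^sub>C k n"]
      by (simp add: b_def quad_scaleC[OF p] diff_diff_eq)
    then have bp: "(\<lambda>n. quad p (f - b n)) \<longlonglongrightarrow> 0"
      by (intro tendsto_sandwich[OF _ _ tendsto_const lim2[OF g(3) kp]])
        (auto simp: quad_nonneg[OF p])
    have "(\<lambda>n. \<phi> f - (\<phi> (g n) + \<phi> f * \<phi> (k n))) \<longlonglongrightarrow> \<phi> f - (0 + \<phi> f * 1)"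
      by (intro tendsto_intros g(2) k\<phi>)
    then have "(\<lambda>n. \<phi> (f - b n)) \<longlonglongrightarrow> 0" by (simp add: b_def minus add scale)
    then have "(\<lambda>n. (cmod (\<phi> (f - b n)))\<^sup>2) \<longlonglongrightarrow> 0\<^sup>2"
      by (intro tendsto_power tendsto_norm_zero)
    with bp have "(\<lambda>n. quad t2 (f - b n)) \<longlonglongrightarrow> 0"
      unfolding q2 using tendsto_add[OF bp] by force
    with bw show "\<exists>b. (\<lambda>n. quad w (b n)) \<longlonglongrightarrow> 0 \<and> (\<lambda>n. quad t2 (f - b n)) \<longlonglongrightarrow> 0" by blast
  qed
  moreover have "t1 \<noteq> form_D w t"
  proof
    assume "t1 = form_D w t"
    then have "quad s (u 0) = 0" using q1[of "u 0"] by simp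
    then show False by (simp add: qs u1)
  qed
  ultimately show thesis using that[OF t1 le ac] by (simp add: t2_def[abs_def])
qed

section \<open>Kernels and their forms\<close>

text \<open>The supports vary with the arguments; a common finite index set lets additivity and
  homogeneity be checked termwise.\<close>

lemma kernel_form_superset:
  assumes "finite A" "finite B" "Poly_Mapping.keys g \<subseteq> A" "Poly_Mapping.keys f \<subseteq> B"
  shows "kernel_form K f g = (\<Sum>s\<in>A. \<Sum>t\<in>B. pairing (Poly_Mapping.lookup f t)
    (blinfun_apply (K s t) (Poly_Mapping.lookup g s)))"
proof -
  have "(\<Sum>t\<in>Poly_Mapping.keys f. pairing (Poly_Mapping.lookup f t)
      (blinfun_apply (K s t) (Poly_Mapping.lookup g s)))
    = (\<Sum>t\<in>B. pairing (Poly_Mapping.lookup f t) (blinfun_apply (K s t) (Poly_Mapping.lookup g s)))"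
    for s using assms
    by (intro sum.mono_neutral_left) (auto simp: in_keys_iff pairing_def blinfun.zero_right)
  then show ?thesis
    unfolding kernel_form_def using assms
    by (simp, intro sum.mono_neutral_left)
      (auto simp: in_keys_iff pairing_def blinfun.zero_right blinfun.zero_left)
qed

lemma kernel_form_single:
  "kernel_form K (Poly_Mapping.single t x) (Poly_Mapping.single s y)
    = pairing x (blinfun_apply (K s t) y)"
  by (subst kernel_form_superset[of "{s}" "{t}"]) auto

lemma kernel_form_diff:
  "kernel_form (\<lambda>s t. K s t - D s t) = (\<lambda>f g. kernel_form K f g - kernel_form D f g)"
  by (intro ext) (simp add: kernel_form_def pairing_def blinfun.diff_left sum_subtractf)

text \<open>Functions supported at one point read off the entries of a kernel.\<close>

lemma kernel_form_inj:
  assumes "kernel_form K = kernel_form D" shows "K = D"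
proof (intro ext blinfun_eqI)
  fix s t y x
  show "blinfun_apply (blinfun_apply (K s t) y) x = blinfun_apply (blinfun_apply (D s t) y) x"
    using kernel_form_single[of K t x s y] kernel_form_single[of D t x s y] assms
    by (simp add: pairing_def)
qed

lemma keys_scaleC: "Poly_Mapping.keys (c *\<^sub>C f) \<subseteq> Poly_Mapping.keys f"
  by (auto simp: in_keys_iff scaleC_poly_mapping.rep_eq)

lemma is_form_kernel_form:
  fixes K :: "('s, 'e::complex_banach) op_fun"
  assumes "is_kernel K" shows "is_form (kernel_form K)"
proof -
  have bo: "K s t \<in> bounded_ops" for s t using assms by (simp add: is_kernel_def)
  have l: "pairing (c *\<^sub>C x) (blinfun_apply (K s t) y) = c * pairing x (blinfun_apply (K s t) y)"
    for c x y s t using bo[of s t] by (simp add: bounded_ops_def dual_space_def pairing_def)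
  have r: "pairing x (blinfun_apply (K s t) (c *\<^sub>C y)) = cnj c * pairing x (blinfun_apply (K s t) y)"
    for c x y s t using bo[of s t] by (simp add: bounded_ops_def dual_scale_def pairing_def)
  let ?k = "Poly_Mapping.keys"
  show ?thesis unfolding is_form_def
  proof (intro conjI allI)
    fix f f' g g' :: "'s \<Rightarrow>\<^sub>0 'e" and c
    have sup: "kernel_form K a b = (\<Sum>s\<in>?k g \<union> ?k g'. \<Sum>t\<in>?k f \<union> ?k f'.
        pairing (Poly_Mapping.lookup a t) (blinfun_apply (K s t) (Poly_Mapping.lookup b s)))"
      if "?k a \<subseteq> ?k f \<union> ?k f'" "?k b \<subseteq> ?k g \<union> ?k g'" for a b
      using that by (intro kernel_form_superset) simp_all
    have sub: "?k f \<subseteq> ?k f \<union> ?k f'" "?k f' \<subseteq> ?k f \<union> ?k f'" "?k g \<subseteq> ?k g \<union> ?k g'"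
      "?k g' \<subseteq> ?k g \<union> ?k g'" by simp_all
    have subc: "?k (c *\<^sub>C f) \<subseteq> ?k f \<union> ?k f'" "?k (c *\<^sub>C g) \<subseteq> ?k g \<union> ?k g'"
      using keys_scaleC[of c f] keys_scaleC[of c g] by auto
    show "kernel_form K (f + f') g = kernel_form K f g + kernel_form K f' g"
      unfolding sup[OF keys_add sub(3)] sup[OF sub(1,3)] sup[OF sub(2,3)]
      by (simp only: lookup_add pairing_def blinfun.add_right sum.distrib)
    show "kernel_form K f (g + g') = kernel_form K f g + kernel_form K f g'"
      unfolding sup[OF sub(1) keys_add] sup[OF sub(1,3)] sup[OF sub(1,4)]
      by (simp only: lookup_add pairing_def blinfun.add_right blinfun.add_left sum.distrib)
    show "kernel_form K (c *\<^sub>C f) g = c * kernel_form K f g"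
      unfolding sup[OF subc(1) sub(3)] sup[OF sub(1,3)]
      by (simp only: scaleC_poly_mapping.rep_eq l sum_distrib_left)
    show "kernel_form K f (c *\<^sub>C g) = cnj c * kernel_form K f g"
      unfolding sup[OF sub(1) subc(2)] sup[OF sub(1,3)]
      by (simp only: scaleC_poly_mapping.rep_eq r sum_distrib_left)
    show "kernel_form K f f \<in> \<real>\<^sub>\<ge>\<^sub>0" using assms by (simp add: is_kernel_def)
  qed
qed

lemma is_kernelI:
  assumes "\<And>s t. K s t \<in> bounded_ops" "is_form (kernel_form K)" shows "is_kernel K"
  using assms form_self_nonneg by (auto simp: is_kernel_def)

lemma bounded_ops_diff:
  assumes "S \<in> bounded_ops" "T \<in> bounded_ops" shows "S - T \<in> bounded_ops"
proof -
  have "blinfun_apply (dual_scale c p - dual_scale c q) x = blinfun_apply (dual_scale c (p - q)) x"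
    for c :: complex and p q :: "'a \<Rightarrow>\<^sub>L complex" and x
    by (simp add: dual_scale_def blinfun.diff_left algebra_simps)
  then have "dual_scale c p - dual_scale c q = dual_scale c (p - q)"
    for c :: complex and p q :: "'a \<Rightarrow>\<^sub>L complex"
    by (intro blinfun_eqI) auto
  with assms show ?thesis
    by (simp add: bounded_ops_def dual_space_def blinfun.diff_left right_diff_distrib)
qed

section \<open>Kernels recovered from forms\<close>

lemma sum_singles:
  "f = (\<Sum>k\<in>Poly_Mapping.keys f. Poly_Mapping.single k (Poly_Mapping.lookup f k))"
proof (rule poly_mapping_eqI)
  fix j
  show "Poly_Mapping.lookup f j = Poly_Mapping.lookup
      (\<Sum>k\<in>Poly_Mapping.keys f. Poly_Mapping.single k (Poly_Mapping.lookup f k)) j"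
    by (simp add: lookup_sum lookup_single when_def in_keys_iff)
qed

lemma form_sum_left:
  assumes "is_form v" shows "v (sum F A) y = (\<Sum>a\<in>A. v (F a) y)"
  using form_scaleC_left[OF assms, of 0 0]
  by (induction A rule: infinite_finite_induct) (simp_all add: form_simps[OF assms])

lemma form_sum_right:
  assumes "is_form v" shows "v y (sum F A) = (\<Sum>a\<in>A. v y (F a))"
  using form_scaleC_right[OF assms, of _ 0 0]
  by (induction A rule: infinite_finite_induct) (simp_all add: form_simps[OF assms])

lemma single_scaleC: "Poly_Mapping.single t (c *\<^sub>C x) = c *\<^sub>C Poly_Mapping.single t x"
  by (rule poly_mapping_eqI) (simp add: scaleC_poly_mapping.rep_eq lookup_single when_def)

text \<open>The entries are bounded by the Cauchy--Schwarz inequality for the form.\<close>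

lemma kernel_of_form:
  fixes K :: "('s, 'e::complex_banach) op_fun"
  assumes v: "is_form v" and le: "form_le v (kernel_form K)"
  obtains D where "is_kernel D" "kernel_form D = v"
proof -
  let ?e = "\<lambda>t x. Poly_Mapping.single t x :: 's \<Rightarrow>\<^sub>0 'e"
  \<comment> \<open>On functions supported at \<open>t\<close>, the form of \<open>K\<close> is
    controlled by the norm of the diagonal entry \<open>K t t\<close>.\<close>
  have qb: "sqrt (quad v (?e t x)) \<le> sqrt (norm (K t t)) * norm x" for t x
  proof -
    have "quad v (?e t x) \<le> quad (kernel_form K) (?e t x)"
      using le by (simp add: form_le_def)
    also have "\<dots> \<le> cmod (blinfun_apply (blinfun_apply (K t t) x) x)"
      by (simp add: quad_def kernel_form_single pairing_def complex_Re_le_cmod)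
    also have "\<dots> \<le> norm (blinfun_apply (K t t) x) * norm x" by (rule norm_blinfun)
    also have "\<dots> \<le> norm (K t t) * norm x * norm x"
      by (intro mult_right_mono norm_blinfun) simp
    finally have "sqrt (quad v (?e t x)) \<le> sqrt (norm (K t t) * norm x * norm x)" by simp
    then show ?thesis by (simp add: real_sqrt_mult mult.assoc)
  qed
  \<comment> \<open>The vector \<open>y\<close> at \<open>s\<close> comes first, since the operator
    acts on it and the result is then paired with \<open>x\<close>. Real bilinearity suits the
    bounded function type; compatibility with complex scalars is checked in
    \<open>bo\<close>.\<close>
  have bil: "bounded_bilinear (\<lambda>y x. v (?e t x) (?e s y))" for s t
  proof
    show "v (?e t x) (?e s (y + y')) = v (?e t x) (?e s y) + v (?e t x) (?e s y')" for x y y'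
      by (simp add: single_add form_simps[OF v])
    show "v (?e t (x + x')) (?e s y) = v (?e t x) (?e s y) + v (?e t x') (?e s y)" for x x' y
      by (simp add: single_add form_simps[OF v])
    show "v (?e t x) (?e s (r *\<^sub>R y)) = r *\<^sub>R v (?e t x) (?e s y)" for x y r
      by (simp add: scaleR_scaleC single_scaleC form_simps[OF v] scaleR_conv_of_real)
    show "v (?e t (r *\<^sub>R x)) (?e s y) = r *\<^sub>R v (?e t x) (?e s y)" for x y r
      by (simp add: scaleR_scaleC single_scaleC form_simps[OF v] scaleR_conv_of_real)
    show "\<exists>C. \<forall>y x. cmod (v (?e t x) (?e s y)) \<le> norm y * norm x * C"
    proof (intro exI allI)
      fix y x
      have "cmod (v (?e t x) (?e s y)) \<le> sqrt (quad v (?e t x)) * sqrt (quad v (?e s y))"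
        by (rule cmod_form_le[OF v])
      also have "\<dots> \<le> (sqrt (norm (K t t)) * norm x) * (sqrt (norm (K s s)) * norm y)"
        by (intro mult_mono qb) (auto simp: quad_nonneg[OF v])
      finally show "cmod (v (?e t x) (?e s y))
          \<le> norm y * norm x * (sqrt (norm (K t t)) * sqrt (norm (K s s)))"
        by (simp add: mult_ac)
    qed
  qed
  define D where
    "D s t = Blinfun (bounded_bilinear.prod_right (\<lambda>y x. v (?e t x) (?e s y)))" for s t
  have D: "blinfun_apply (blinfun_apply (D s t) y) x = v (?e t x) (?e s y)" for s t x y
    unfolding D_def
      bounded_linear_Blinfun_apply[OF bounded_bilinear.bounded_linear_prod_right[OF bil]]
    by (simp add: bounded_bilinear.prod_right.rep_eq[OF bil])
  have bo: "D s t \<in> bounded_ops" for s t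
    by (auto simp: bounded_ops_def dual_space_def dual_scale_def D single_scaleC form_simps[OF v]
        intro!: blinfun_eqI)
  have eq: "kernel_form D = v"
  proof (intro ext)
    fix f g
    have "v f g = v (\<Sum>t\<in>Poly_Mapping.keys f. ?e t (Poly_Mapping.lookup f t))
        (\<Sum>s\<in>Poly_Mapping.keys g. ?e s (Poly_Mapping.lookup g s))"
      using sum_singles[of f] sum_singles[of g] by simp
    then show "kernel_form D f g = v f g"
      by (simp add: form_sum_left[OF v] form_sum_right[OF v] kernel_form_def pairing_def D)
  qed
  show thesis by (rule that[OF is_kernelI[OF bo] eq]) (simp add: eq v)
qed

text \<open>Shared by the canonical decomposition and by the competing one that refutes
  uniqueness.\<close>

lemma lebesgue_type_decomposition_complement:
  assumes K: "is_kernel K" and K1: "is_kernel K1"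
    and le: "form_le (kernel_form K1) (kernel_form K)"
    and ac: "form_strongly_ac (kernel_form K1) (kernel_form L)"
    and sing: "form_singular (\<lambda>f g. kernel_form K f g - kernel_form K1 f g) (kernel_form L)"
  shows "lebesgue_type_decomposition K L K1 (\<lambda>s t. K s t - K1 s t)"
proof -
  have "is_kernel (\<lambda>s t. K s t - K1 s t)"
    using K K1 is_form_diff[OF is_form_kernel_form[OF K] is_form_kernel_form[OF K1] le]
    by (intro is_kernelI) (auto simp: bounded_ops_diff kernel_form_diff is_kernel_def)
  with K1 ac sing show ?thesis
    by (simp add: lebesgue_type_decomposition_def kernel_strongly_ac_def kernel_singular_def
        kernel_form_diff)
qed

text \<open>The definite description is justified: \<open>D \<le> t\<close> gives a kernel for the
  form, and a form determines its kernel.\<close>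

lemma
  assumes K: "is_kernel K" and L: "is_kernel L"
  shows is_kernel_kernel_D: "is_kernel (kernel_D L K)"
    and kernel_form_kernel_D:
      "kernel_form (kernel_D L K) = form_D (kernel_form L) (kernel_form K)"
proof -
  note t = is_form_kernel_form[OF K] and w = is_form_kernel_form[OF L]
  have "\<exists>!D. is_kernel D \<and> kernel_form D = form_D (kernel_form L) (kernel_form K)"
    using kernel_of_form[OF is_form_form_D[OF t w] form_le_form_D[OF t w]] kernel_form_inj
    by metis
  from theI'[OF this]
  show "is_kernel (kernel_D L K)"
    "kernel_form (kernel_D L K) = form_D (kernel_form L) (kernel_form K)"
    by (simp_all add: kernel_D_def)
qed

lemma lebesgue_type_decomposition_kernel_D:
  assumes K: "is_kernel K" and L: "is_kernel L"
  shows "lebesgue_type_decomposition K L (kernel_D L K) (\<lambda>s t. K s t - kernel_D L K s t)"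
proof -
  note t = is_form_kernel_form[OF K] and w = is_form_kernel_form[OF L]
  show ?thesis
    by (rule lebesgue_type_decomposition_complement[OF K is_kernel_kernel_D[OF K L]])
      (simp_all add: kernel_form_kernel_D[OF K L] form_le_form_D form_D_strongly_ac
        form_D_singular t w)
qed

text \<open>Both directions are inherited from forms: a competing absolutely continuous part lies
  below the form of \<open>K\<close>, so it comes from a kernel, and the first summand determines
  the second.\<close>

lemma unique_lebesgue_type_decomposition_iff:
  assumes K: "is_kernel K" and L: "is_kernel L"
  shows "(\<exists>!p. lebesgue_type_decomposition K L (fst p) (snd p)) \<longleftrightarrow>
    kernel_dominated (kernel_D L K) L"
proof
  note t = is_form_kernel_form[OF K] and w = is_form_kernel_form[OF L]
  note eq = kernel_form_kernel_D[OF K L] and dec = lebesgue_type_decomposition_kernel_D[OF K L]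
  {
    assume uniq: "\<exists>!p. lebesgue_type_decomposition K L (fst p) (snd p)"
    show "kernel_dominated (kernel_D L K) L"
    proof (rule ccontr)
      assume "\<not> kernel_dominated (kernel_D L K) L"
      then have "\<not> form_dominated (form_D (kernel_form L) (kernel_form K)) (kernel_form L)"
        by (simp add: kernel_dominated_def eq)
      from form_decomposition_not_unique[OF t w this] obtain t1 where t1: "is_form t1"
        "form_le t1 (kernel_form K)" "form_strongly_ac t1 (kernel_form L)"
        "form_singular (\<lambda>f g. kernel_form K f g - t1 f g) (kernel_form L)"
        "t1 \<noteq> form_D (kernel_form L) (kernel_form K)" by blast
      obtain K1 where K1: "is_kernel K1" "kernel_form K1 = t1"
        by (rule kernel_of_form[OF t1(1,2)])
      have "lebesgue_type_decomposition K L K1 (\<lambda>s t. K s t - K1 s t)"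
        by (rule lebesgue_type_decomposition_complement[OF K K1(1)]) (simp_all add: K1(2) t1)
      moreover obtain p where p: "\<And>q. lebesgue_type_decomposition K L (fst q) (snd q) \<Longrightarrow> q = p"
        using uniq by (elim ex1E) blast
      ultimately have "(K1, \<lambda>s t. K s t - K1 s t) = p" by (intro p) simp
      then have "K1 = fst p" by auto
      moreover have "(kernel_D L K, \<lambda>s t. K s t - kernel_D L K s t) = p"
        using dec by (intro p) simp
      then have "kernel_D L K = fst p" by auto
      ultimately have "K1 = kernel_D L K" by simp
      with K1(2) t1(5) eq show False by simp
    qed
  next
    assume dom: "kernel_dominated (kernel_D L K) L"
    show "\<exists>!p. lebesgue_type_decomposition K L (fst p) (snd p)"
    proof (rule ex1I)
      show "lebesgue_type_decomposition K L
          (fst (kernel_D L K, \<lambda>s t. K s t - kernel_D L K s t))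
          (snd (kernel_D L K, \<lambda>s t. K s t - kernel_D L K s t))" using dec by simp
      fix p assume p: "lebesgue_type_decomposition K L (fst p) (snd p)"
      obtain K1 K2 where p12: "p = (K1, K2)" by (cases p)
      have K1: "is_kernel K1" and K2: "is_kernel K2" and sum: "\<And>s t. K s t = K1 s t + K2 s t"
        and ac: "form_strongly_ac (kernel_form K1) (kernel_form L)"
        and sing: "form_singular (kernel_form K2) (kernel_form L)"
        using p by (auto simp: p12 lebesgue_type_decomposition_def kernel_strongly_ac_def
            kernel_singular_def)
      have K2_eq: "K2 = (\<lambda>s t. K s t - K1 s t)" by (simp add: sum)
      have "kernel_form K1 = form_D (kernel_form L) (kernel_form K)"
      proof (rule form_decomposition_unique[OF t w _ _ _ _ ac sing])
        show "form_dominated (form_D (kernel_form L) (kernel_form K)) (kernel_form L)"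
          using dom by (simp add: kernel_dominated_def eq)
        show "kernel_form K f g = kernel_form K1 f g + kernel_form K2 f g" for f g
          by (simp add: K2_eq kernel_form_diff)
      qed (simp_all add: is_form_kernel_form K1 K2)
      then have "K1 = kernel_D L K" by (intro kernel_form_inj) (simp add: eq)
      with K2_eq p12 show "p = (kernel_D L K, \<lambda>s t. K s t - kernel_D L K s t)" by simp
    qed
  }
qed

theorem theorem2p4:
  fixes K L :: "'s \<Rightarrow> 's \<Rightarrow> ('e::complex_banach \<Rightarrow>\<^sub>L ('e \<Rightarrow>\<^sub>L complex))"
  assumes "is_kernel K" and "is_kernel L"
  shows "kernel_form (kernel_D L K) = form_D (kernel_form L) (kernel_form K)
    \<and> lebesgue_type_decomposition K L (kernel_D L K) (\<lambda>s t. K s t - kernel_D L K s t)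
    \<and> (\<forall>f. quad (kernel_form (kernel_D L K)) f =
           Inf {lim (\<lambda>n. quad (kernel_form K) (f - g n)) | g.
                  form_cauchy (kernel_form K) g \<and> (\<lambda>n. quad (kernel_form L) (g n)) \<longlonglongrightarrow> 0})
    \<and> (\<forall>f. ereal (quad (kernel_form (kernel_D L K)) f) =
           Inf {liminf (\<lambda>n. ereal (quad (kernel_form K) (f - g n))) | g.
                  (\<lambda>n. quad (kernel_form L) (g n)) \<longlonglongrightarrow> 0})
    \<and> ((\<exists>!p. lebesgue_type_decomposition K L (fst p) (snd p)) \<longleftrightarrow>
           kernel_dominated (kernel_D L K) L)"
proof -
  note t = is_form_kernel_form[OF assms(1)] and w = is_form_kernel_form[OF assms(2)]
  show ?thesis
    unfolding unique_lebesgue_type_decomposition_iff[OF assms] kernel_form_kernel_D[OF assms]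
    by (intro conjI allI refl lebesgue_type_decomposition_kernel_D[OF assms]
        form_D_eq_Inf_lim[OF t w] form_D_eq_Inf_liminf[OF t w])
qed

end
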